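(* Let $0<\alpha\le2$, $d\ge2$, let $\Omega\subseteq\mathbb{R}^d$ be Lebesgue measurable with finite measure, and let $k\in\mathbb N$. Define $$T^{(k)}_\Omega(t)=\int_{\mathbb{R}^d}dx\int_{\mathbb{R}^d}dy\,p^{(\alpha)}_t(x,y)\,\mathbb{E}^t_{x,y}\!\left[\Big(\int_0^t\mathbb{1}_\Omega(X_s)\,ds\Big)^k\right].$$ Then for all $t\ge0$: (a) $t^kQ^{(\alpha)}_\Omega(t)\le T^{(k)}_\Omega(t)\le t^k|\Omega|$; (b) $T^{(k)}_\Omega(t)=k!\,t^k\displaystyle\int_{I_k}h^{(k)}_\Omega(t,\lambda_2-\lambda_1,\dots,\lambda_k-\lambda_{k-1})\,d\lambda_1\cdots d\lambda_k$. Moreover, $\lim_{t\to0^+}t^{-k}T^{(k)}_\Omega(t)=|\Omega|$.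
   Context: $\mathbf X$ is the rotationally invariant $\alpha$-stable process in $\mathbb{R}^d$ with transition densities $p^{(\alpha)}_t(x,y)=p^{(\alpha)}_t(x-y)$ determined by $\int_{\mathbb{R}^d}e^{-iy\cdot\xi}p^{(\alpha)}_t(y)dy=e^{-t|\xi|^\alpha}$; $\mathbb P_x$ denotes the law of $\mathbf X$ started at $x$. For $x,y\in\mathbb{R}^d$, $t>0$, $\mathbb{E}^t_{x,y}$ denotes expectation for the $\alpha$-stable bridge from $x$ to $y$ of length $t$, whose finite-dimensional distributions for $0<s_1<\dots<s_k<t$ are $$\mathbb{P}^t_{x,y}(X_{s_1}\in dz_1,\dots,X_{s_k}\in dz_k)=\frac{p^{(\alpha)}_{s_1}(x,z_1)\prod_{j=1}^{k-1}p^{(\alpha)}_{s_{j+1}-s_j}(z_j,z_{j+1})\,p^{(\alpha)}_{t-s_k}(z_k,y)}{p^{(\alpha)}_t(x,y)}\,dz_1\cdots dz_k.$$ The spectral heat content is $Q^{(\alpha)}_\Omega(t)=\int_\Omega\mathbb P_x(X_s\in\Omega\ \forall s\le t)\,dx$. $I_k=\{(\lambda_1,\dots,\lambda_k)\in[0,1]^k:0<\lambda_1<\dots<\lambda_k<1\}$, and for $t,a_1,\dots,a_{k-1}>0$, $$h^{(k)}_\Omega(t,a_1,\dots,a_{k-1})=\int_{\Omega^k}\prod_{j=1}^{k-1}p^{(\alpha)}_{ta_j}(z_j,z_{j+1})\,dz_1\cdots dz_k$$ (for $k=1$, $h^{(1)}_\Omega=|\Omega|$). $|\Omega|$ is Lebesgue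 measure. *)

theory Defs
  imports "HOL-Probability.Probability"
begin

text \<open>Transition density of the rotationally invariant alpha-stable process in the
  Euclidean space 'a, given by Fourier inversion of exp(-t |xi|^alpha):
  p_t(z) = (2 pi)^(-d) * integral of cos(z . xi) exp(-t |xi|^alpha) d xi.
  The two-point density is p_t(x,y) = p_t(x - y).\<close>
definition stable_density :: "real \<Rightarrow> real \<Rightarrow> 'a::euclidean_space \<Rightarrow> real" where
  "stable_density \<alpha> t z =
     (1 / (2 * pi) ^ DIM('a)) * (\<integral>\<xi>. cos (z \<bullet> \<xi>) * exp (- t * norm \<xi> powr \<alpha>) \<partial>lborel)"

definition ptd :: "real \<Rightarrow> real \<Rightarrow> 'a::euclidean_space \<Rightarrow> 'a \<Rightarrow> real" where
  "ptd \<alpha> t x y = stable_density \<alpha> t (x - y)"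

text \<open>Iterated finite-dimensional density integral: starting at point z at time r,
  visit the sets A_1,...,A_n at the times s_1,...,s_n (list of pairs (s_i, A_i)),
  and finish with the terminal weight g (time of last visit, last position).\<close>
fun fdd_chain :: "real \<Rightarrow> (real \<Rightarrow> 'a \<Rightarrow> real) \<Rightarrow> real \<Rightarrow> 'a::euclidean_space
                   \<Rightarrow> (real \<times> 'a set) list \<Rightarrow> real" where
  "fdd_chain \<alpha> g r z [] = g r z"
| "fdd_chain \<alpha> g r z ((s, A) # rest) =
     (\<integral>w. indicator A w * ptd \<alpha> (s - r) z w * fdd_chain \<alpha> g s w rest \<partial>lborel)"


definition cadlag_on :: "real set \<Rightarrow> (real \<Rightarrow> 'a::topological_space) \<Rightarrow> bool" where
  "cadlag_on I f \<longleftrightarrow>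
     (\<forall>s\<in>I. (f \<longlongrightarrow> f s) (at_right s)) \<and> (\<forall>s\<in>I. \<exists>l. (f \<longlongrightarrow> l) (at_left s))"

definition is_stable_process ::
  "real \<Rightarrow> ('a::euclidean_space \<Rightarrow> 'w measure) \<Rightarrow> (real \<Rightarrow> 'w \<Rightarrow> 'a) \<Rightarrow> bool" where
  "is_stable_process \<alpha> P X \<longleftrightarrow>
     (\<forall>x. prob_space (P x)
        \<and> (\<forall>s. X s \<in> borel_measurable (P x))
        \<and> (\<forall>\<omega>\<in>space (P x). cadlag_on {0..} (\<lambda>s. X s \<omega>))
        \<and> (AE \<omega> in P x. X 0 \<omega> = x)
        \<and> (\<forall>ss. sorted_wrt (<) (map fst ss) \<and> (\<forall>p\<in>set ss. 0 < fst p)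
               \<and> (\<forall>p\<in>set ss. snd p \<in> sets borel) \<longrightarrow>
             measure (P x) {\<omega>\<in>space (P x). \<forall>p\<in>set ss. X (fst p) \<omega> \<in> snd p}
               = fdd_chain \<alpha> (\<lambda>_ _. 1) 0 x ss))"

definition is_stable_bridge ::
  "real \<Rightarrow> real \<Rightarrow> 'a::euclidean_space \<Rightarrow> 'a \<Rightarrow> 'w measure \<Rightarrow> (real \<Rightarrow> 'w \<Rightarrow> 'a) \<Rightarrow> bool" where
  "is_stable_bridge \<alpha> t x y B X \<longleftrightarrow>
     prob_space B
     \<and> (\<forall>s. X s \<in> borel_measurable B)
     \<and> (\<forall>\<omega>\<in>space B. cadlag_on {0..t} (\<lambda>s. X s \<omega>))
     \<and> (\<forall>ss. sorted_wrt (<) (map fst ss) \<and> (\<forall>p\<in>set ss. 0 < fst p \<and> fst p < t)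
            \<and> (\<forall>p\<in>set ss. snd p \<in> sets borel) \<longrightarrow>
          measure B {\<omega>\<in>space B. \<forall>p\<in>set ss. X (fst p) \<omega> \<in> snd p}
            = fdd_chain \<alpha> (\<lambda>r z. ptd \<alpha> (t - r) z y) 0 x ss / ptd \<alpha> t x y)"

text \<open>Spectral heat content Q(t) = int_Omega P_x(X_s in Omega for all s <= t) dx.
  The survival probability is taken as an outer probability (it coincides with the
  probability whenever the event is measurable).\<close>
definition spectral_heat_content ::
  "('a::euclidean_space \<Rightarrow> 'w measure) \<Rightarrow> (real \<Rightarrow> 'w \<Rightarrow> 'a) \<Rightarrow> 'a set \<Rightarrow> real \<Rightarrow> real" where
  "spectral_heat_content P X \<Omega> t =
     enn2real (\<integral>\<^sup>+ x. indicator \<Omega> x *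
        outer_measure_of (P x) {\<omega>\<in>space (P x). \<forall>s\<in>{0..t}. X s \<omega> \<in> \<Omega>} \<partial>lebesgue)"

definition occupation :: "'a set \<Rightarrow> (real \<Rightarrow> 'w \<Rightarrow> 'a) \<Rightarrow> real \<Rightarrow> 'w \<Rightarrow> real" where
  "occupation \<Omega> X t \<omega> = (LINT s:{0..t}|lebesgue. indicator \<Omega> (X s \<omega>))"

definition Tk ::
  "real \<Rightarrow> (real \<Rightarrow> 'a::euclidean_space \<Rightarrow> 'a \<Rightarrow> 'w measure) \<Rightarrow> (real \<Rightarrow> 'w \<Rightarrow> 'a)
     \<Rightarrow> 'a set \<Rightarrow> nat \<Rightarrow> real \<Rightarrow> real" where
  "Tk \<alpha> B X \<Omega> k t =
     (\<integral>x. (\<integral>y. ptd \<alpha> t x y *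
        (\<integral>\<omega>. (occupation \<Omega> X t \<omega>) ^ k \<partial>completion (B t x y)) \<partial>lebesgue) \<partial>lebesgue)"

text \<open>h^(k)_Omega(t, a_1, ..., a_{k-1}) = int_{Omega^k} prod_j p_{t a_j}(z_j, z_{j+1}) dz,
  written as an iterated integral; the list argument is [a_1, ..., a_{k-1}].\<close>
fun h_chain :: "real \<Rightarrow> 'a set \<Rightarrow> real \<Rightarrow> 'a::euclidean_space \<Rightarrow> real list \<Rightarrow> real" where
  "h_chain \<alpha> \<Omega> t z [] = 1"
| "h_chain \<alpha> \<Omega> t z (a # as) =
     (\<integral>w. indicator \<Omega> w * ptd \<alpha> (t * a) z w * h_chain \<alpha> \<Omega> t w as \<partial>lebesgue)"

definition hk :: "real \<Rightarrow> 'a::euclidean_space set \<Rightarrow> real \<Rightarrow> real list \<Rightarrow> real" where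
  "hk \<alpha> \<Omega> t as = (\<integral>z. indicator \<Omega> z * h_chain \<alpha> \<Omega> t z as \<partial>lebesgue)"

definition simplex_I :: "nat \<Rightarrow> (nat \<Rightarrow> real) set" where
  "simplex_I k = {l \<in> {..<k} \<rightarrow>\<^sub>E UNIV. (\<forall>i<k. 0 < l i \<and> l i < 1) \<and> (\<forall>i. Suc i < k \<longrightarrow> l i < l (Suc i))}"

end

theory Submission
  imports Defs "HOL-Combinatorics.Permutations"
begin

text \<open>
  The \<open>k\<close>-th power of the occupation time is an integral over the cube \<open>[0,t]\<^sup>k\<close>; by symmetry it is
  \<open>k!\<close> times the integral over increasing times, and Tonelli's theorem brings in the
  finite-dimensional distributions of the bridge. Integrating out the two end points, where the
  transition density has mass one, leaves \<open>h\<close>: this is (b). The upper bound in (a) follows from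
  \<open>h \<le> |\<Omega>|\<close> and the volume \<open>1/k!\<close> of the simplex, the lower bound from the fact that a path staying
  in \<open>\<Omega>\<close> visits \<open>\<Omega>\<close> at any given times, so that \<open>Q \<le> h\<close>. For the limit, \<open>|\<Omega>| - h\<close> is at most the sum
  over \<open>j\<close> of the probabilities, integrated over the starting point in \<open>\<Omega>\<close>, of being outside \<open>\<Omega>\<close> after
  time \<open>t(\<lambda>\<^sub>j - \<lambda>\<^sub>1)\<close>; these vanish by right-continuity of the paths and outer regularity.

  No Fourier analysis is needed: positivity, unit mass and the Chapman-Kolmogorov identity for the
  density all follow from its being the density of a process and of its bridges. As \<open>\<Omega>\<close> is only
  Lebesgue measurable, it is replaced by a Borel superset \<open>A\<close> with \<open>A - \<Omega>\<close> null.
\<close>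

section \<open>Symmetrisation over the cube\<close>

interpretation lborel_PiM: product_sigma_finite "\<lambda>_::'i. lborel :: 'b::euclidean_space measure"
  by standard

text \<open>A product measure is determined by its values on boxes. Permuting coordinates pulls the
  box with sides \<open>E i\<close> back to the box with sides \<open>E (inv \<sigma> i)\<close>,
  and reindexing leaves the product of the side measures unchanged.\<close>

lemma distr_PiM_lborel_permutes:
  assumes I: "finite I" and \<sigma>: "\<sigma> permutes I"
  shows "distr (PiM I (\<lambda>_. lborel :: 'b::euclidean_space measure)) (PiM I (\<lambda>_. lborel))
           (\<lambda>l. \<lambda>i\<in>I. l (\<sigma> i)) = PiM I (\<lambda>_. lborel)"
proof (rule lborel_PiM.PiM_eqI[OF I])
  let ?M = "PiM I (\<lambda>_. lborel :: 'b measure)" and ?f = "\<lambda>l :: 'a \<Rightarrow> 'b. \<lambda>i\<in>I. l (\<sigma> i)"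
  have \<sigma>_in: "\<sigma> i \<in> I \<longleftrightarrow> i \<in> I" for i
    using permutes_in_image[OF \<sigma>] .
  have [measurable]: "?f \<in> measurable ?M ?M"
    by (intro measurable_restrict) (simp add: \<sigma>_in)
  fix E :: "'a \<Rightarrow> 'b set" assume E: "\<And>i. i \<in> I \<Longrightarrow> E i \<in> sets lborel"
  have "?f -` Pi\<^sub>E I E \<inter> space ?M = Pi\<^sub>E I (\<lambda>i. E (inv \<sigma> i))" (is "?L = ?R")
  proof (intro set_eqI iffI)
    fix l assume l: "l \<in> ?L"
    show "l \<in> ?R"
    proof
      fix i assume "i \<in> I"
      then have "inv \<sigma> i \<in> I" using permutes_in_image[OF permutes_inv[OF \<sigma>]] by simp
      moreover have "\<sigma> (inv \<sigma> i) = i" using permutes_inverses(1)[OF \<sigma>] .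
      ultimately show "l i \<in> E (inv \<sigma> i)" using l by (fastforce simp: PiE_iff)
    qed (use l in \<open>auto simp: space_PiM\<close>)
  next
    fix l assume "l \<in> ?R"
    then show "l \<in> ?L"
      using \<sigma>_in permutes_inverses(2)[OF \<sigma>] by (force simp: space_PiM PiE_iff)
  qed
  moreover have "Pi\<^sub>E I E \<in> sets ?M"
    using E I by (intro sets_PiM_I_finite) auto
  moreover have "inv \<sigma> i \<in> I \<longleftrightarrow> i \<in> I" for i
    using permutes_in_image[OF permutes_inv[OF \<sigma>]] .
  ultimately have "emeasure (distr ?M ?M ?f) (Pi\<^sub>E I E) = (\<Prod>i\<in>I. emeasure lborel (E (inv \<sigma> i)))"
    using E I by (simp add: emeasure_distr lborel_PiM.emeasure_PiM)
  also have "\<dots> = (\<Prod>i\<in>I. emeasure lborel (E i))"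
    by (rule prod.permute[OF permutes_inv[OF \<sigma>], of "\<lambda>i. emeasure lborel (E i)", symmetric, unfolded comp_def])
  finally show "emeasure (distr ?M ?M ?f) (Pi\<^sub>E I E) = (\<Prod>i\<in>I. emeasure lborel (E i))" .
qed simp

text \<open>Integrating over coordinate \<open>i\<close> first, each section of the diagonal is the
  single point \<open>l j\<close>, a null set. This is what makes sorting the coordinates
  unambiguous almost everywhere.\<close>

lemma AE_PiM_lborel_neq:
  assumes I: "finite I" "i \<in> I" "j \<in> I" "i \<noteq> j"
  shows "AE l in PiM I (\<lambda>_. lborel :: real measure). l i \<noteq> l j"
proof -
  let ?J = "I - {i}"
  have ins: "insert i ?J = I" using I by auto
  have [measurable]: "(\<lambda>l. l i) \<in> borel_measurable (PiM I (\<lambda>_. lborel))"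
       "(\<lambda>l. l j) \<in> borel_measurable (PiM I (\<lambda>_. lborel))"
    using I by simp_all
  have meas: "(\<lambda>l. if l i = l j then 1 else 0 :: ennreal) \<in> borel_measurable (PiM I (\<lambda>_. lborel))"
    by measurable
  have "(\<integral>\<^sup>+l. (if l i = l j then 1 else 0) \<partial>PiM I (\<lambda>_. lborel :: real measure))
      = (\<integral>\<^sup>+l. (\<integral>\<^sup>+y. (if (l(i := y)) i = (l(i := y)) j then 1 else 0) \<partial>lborel) \<partial>PiM ?J (\<lambda>_. lborel :: real measure))"
    using lborel_PiM.product_nn_integral_insert[of ?J i
      "\<lambda>l :: 'a \<Rightarrow> real. if l i = l j then 1 else 0 :: ennreal"] I(1) meas unfolding ins by simp
  also have "\<dots> = (\<integral>\<^sup>+l. 0 \<partial>PiM ?J (\<lambda>_. lborel :: real measure))"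
  proof (intro nn_integral_cong)
    fix l :: "'a \<Rightarrow> real"
    have "(\<integral>\<^sup>+y. (if (l(i := y)) i = (l(i := y)) j then 1 else 0) \<partial>lborel)
        = (\<integral>\<^sup>+y. indicator {l j} y \<partial>lborel)"
      using I by (intro nn_integral_cong) (auto simp: indicator_def)
    then show "(\<integral>\<^sup>+y. (if (l(i := y)) i = (l(i := y)) j then 1 else 0) \<partial>lborel) = (0::ennreal)" by simp
  qed
  finally have "(\<integral>\<^sup>+l. (if l i = l j then 1 else 0) \<partial>PiM I (\<lambda>_. lborel :: real measure)) = 0"
    by simp
  then have "AE l in PiM I (\<lambda>_. lborel :: real measure). (if l i = l j then 1 else 0) = (0::ennreal)"
    by (subst (asm) nn_integral_0_iff_AE) auto
  then show ?thesis by eventually_elim (auto split: if_splits)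
qed

text \<open>Existence comes from listing the values of \<open>l\<close> in increasing order. For
  uniqueness, a strictly sorted list is determined by its set of elements, and injectivity of
  \<open>l\<close> recovers the permutation from the sorted values.\<close>

lemma ex1_sorting_permutation:
  fixes l :: "nat \<Rightarrow> 'b::linorder"
  assumes inj: "inj_on l {..<k}"
  shows "\<exists>!\<sigma>. \<sigma> permutes {..<k} \<and> (\<forall>i. Suc i < k \<longrightarrow> l (\<sigma> i) < l (\<sigma> (Suc i)))"
proof -
  have sorted_iff: "sorted_wrt (<) (map (l \<circ> \<sigma>) [0..<k]) \<longleftrightarrow> (\<forall>i. Suc i < k \<longrightarrow> l (\<sigma> i) < l (\<sigma> (Suc i)))"
    for \<sigma> :: "nat \<Rightarrow> nat"
    by (subst sorted_wrt_iff_nth_Suc_transp) (auto simp: transp_on_def)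
  have set_eq: "set (map (l \<circ> \<sigma>) [0..<k]) = l ` {..<k}" if "\<sigma> permutes {..<k}" for \<sigma>
    using permutes_image[OF that] by (simp add: atLeast0LessThan flip: image_image image_comp)
  show ?thesis
  proof (rule ex_ex1I)
    define L where "L = sorted_list_of_set (l ` {..<k})"
    have len: "length L = k" unfolding L_def using card_image[OF inj] by simp
    have setL: "set L = l ` {..<k}" unfolding L_def by simp
    have srt: "sorted_wrt (<) L" unfolding L_def by simp
    \<comment> \<open>The index at which \<open>l\<close> takes its \<open>i\<close>-th smallest
      value, extended by the identity because \<open>permutes\<close> constrains all of
      \<open>nat\<close>.\<close>
    define \<tau> where "\<tau> i = (if i < k then inv_into {..<k} l (L ! i) else i)" for i
    have l\<tau>: "l (\<tau> i) = L ! i" if "i < k" for i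
      unfolding \<tau>_def using that len setL nth_mem[of i L] by (simp add: f_inv_into_f)
    have "\<tau> i < k" if "i < k" for i
    proof -
      have "L ! i \<in> l ` {..<k}" using that len setL nth_mem by metis
      then show ?thesis using inv_into_into[of "L ! i" l "{..<k}"] that by (simp add: \<tau>_def)
    qed
    then have sub: "\<tau> ` {..<k} \<subseteq> {..<k}" by auto
    have "inj_on \<tau> {..<k}"
    proof
      fix i j assume "i \<in> {..<k}" "j \<in> {..<k}" "\<tau> i = \<tau> j"
      then have "L ! i = L ! j" using l\<tau>[of i] l\<tau>[of j] by simp
      moreover have "distinct L" unfolding L_def by simp
      ultimately show "i = j" using \<open>i \<in> _\<close> \<open>j \<in> _\<close> len nth_eq_iff_index_eq by auto
    qed
    then have "bij_betw \<tau> {..<k} {..<k}"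
      using sub endo_inj_surj[of "{..<k}" \<tau>] by (auto simp: bij_betw_def)
    then have "\<tau> permutes {..<k}"
      by (rule bij_imp_permutes) (simp add: \<tau>_def)
    moreover have "map (l \<circ> \<tau>) [0..<k] = L"
      using l\<tau> len by (intro nth_equalityI) auto
    then have "\<forall>i. Suc i < k \<longrightarrow> l (\<tau> i) < l (\<tau> (Suc i))"
      using srt sorted_iff[of \<tau>] by (simp only:)
    ultimately show "\<exists>\<sigma>. \<sigma> permutes {..<k} \<and> (\<forall>i. Suc i < k \<longrightarrow> l (\<sigma> i) < l (\<sigma> (Suc i)))"
      by blast
  next
    fix \<sigma> \<tau>
    assume \<sigma>: "\<sigma> permutes {..<k} \<and> (\<forall>i. Suc i < k \<longrightarrow> l (\<sigma> i) < l (\<sigma> (Suc i)))"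
      and \<tau>: "\<tau> permutes {..<k} \<and> (\<forall>i. Suc i < k \<longrightarrow> l (\<tau> i) < l (\<tau> (Suc i)))"
    have "map (l \<circ> \<sigma>) [0..<k] = map (l \<circ> \<tau>) [0..<k]"
    proof (rule strict_sorted_equal)
      show "sorted_wrt (<) (map (l \<circ> \<tau>) [0..<k])" "sorted_wrt (<) (map (l \<circ> \<sigma>) [0..<k])"
        unfolding sorted_iff using \<sigma> \<tau> by simp_all
      show "set (map (l \<circ> \<sigma>) [0..<k]) = set (map (l \<circ> \<tau>) [0..<k])"
        using set_eq[OF conjunct1[OF \<sigma>]] set_eq[OF conjunct1[OF \<tau>]] by (rule trans[OF _ sym])
    qed
    then have eq: "l (\<sigma> i) = l (\<tau> i)" if "i < k" for i
      using that by (auto simp: map_eq_conv)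
    show "\<sigma> = \<tau>"
    proof
      fix i show "\<sigma> i = \<tau> i"
      proof (cases "i < k")
        case True
        then show ?thesis using eq[OF True] \<sigma> \<tau> permutes_in_image[of _ "{..<k}" i]
          by (intro inj_onD[OF inj]) auto
      next
        case False
        then show ?thesis using permutes_not_in[OF conjunct1[OF \<sigma>], of i] permutes_not_in[OF conjunct1[OF \<tau>], of i] by simp
      qed
    qed
  qed
qed

text \<open>Up to a null set the space splits into \<open>fact k\<close> chambers, one for each
  ordering of the coordinates. A permutation of the coordinates preserves the measure and the
  symmetric integrand, so every chamber contributes as much as the increasing one.\<close>

lemma nn_integral_PiM_prod_eq_fact_increasing:
  fixes g :: "real \<Rightarrow> ennreal"
  assumes [measurable]: "g \<in> borel_measurable borel"
  shows "(\<integral>\<^sup>+l. (\<Prod>i<k. g (l i)) \<partial>PiM {..<k} (\<lambda>_. lborel))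
    = fact k * (\<integral>\<^sup>+l. indicator {l. \<forall>i. Suc i < k \<longrightarrow> l i < l (Suc i)} l * (\<Prod>i<k. g (l i))
        \<partial>PiM {..<k} (\<lambda>_. lborel))"
proof -
  let ?M = "PiM {..<k} (\<lambda>_. lborel :: real measure)"
  define inc where "inc = (\<lambda>l :: nat \<Rightarrow> real. \<forall>i. Suc i < k \<longrightarrow> l i < l (Suc i))"
  define perm where "perm \<sigma> l = (\<lambda>i\<in>{..<k}. l (\<sigma> i))" for \<sigma> and l :: "nat \<Rightarrow> real"
  define G where "G l = (\<Prod>i<k. g (l i))" for l :: "nat \<Rightarrow> real"
  define S where "S = {\<sigma>. \<sigma> permutes {..<k}}"
  \<comment> \<open>The quantifier is made to range over a finite set, so that measurability reduces
    to finitely many comparisons.\<close>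
  have inc_alt: "inc l \<longleftrightarrow> (\<forall>i\<in>{i. Suc i < k}. l i < l (Suc i))" for l by (auto simp: inc_def)
  have fin: "finite {i. Suc i < k}" by (rule finite_subset[of _ "{..<k}"]) auto
  have [measurable]: "Measurable.pred ?M inc"
    unfolding inc_alt by (intro pred_intros_finite fin borel_measurable_less) auto
  have [measurable]: "G \<in> borel_measurable ?M"
    unfolding G_def by (intro borel_measurable_prod_ennreal) auto
  have permM: "perm \<sigma> \<in> measurable ?M ?M" if "\<sigma> \<in> S" for \<sigma>
    unfolding perm_def using that permutes_in_image[of \<sigma> "{..<k}"]
    by (intro measurable_restrict) (simp add: S_def)
  have G_perm: "G (perm \<sigma> l) = G l" if "\<sigma> \<in> S" for \<sigma> l
    unfolding G_def perm_def using that prod.permute[of \<sigma> "{..<k}" "\<lambda>i. g (l i)"]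
    by (simp add: S_def comp_def)
  \<comment> \<open>The chambers form a partition of unity: exactly one permutation sorts a point
    with distinct coordinates.\<close>
  have part: "AE l in ?M. (\<Sum>\<sigma>\<in>S. indicator {l. inc l} (perm \<sigma> l)) = (1 :: ennreal)"
  proof -
    have "AE l in ?M. \<forall>i\<in>{..<k}. \<forall>j\<in>{..<k} - {i}. l i \<noteq> l j"
      by (intro AE_finite_allI AE_PiM_lborel_neq) auto
    then show ?thesis
    proof eventually_elim
      case (elim l)
      then have "inj_on l {..<k}" by (auto simp: inj_on_def)
      from ex1_sorting_permutation[OF this] obtain \<tau> where
        "\<And>\<sigma>. \<sigma> permutes {..<k} \<and> (\<forall>i. Suc i < k \<longrightarrow> l (\<sigma> i) < l (\<sigma> (Suc i))) \<longleftrightarrow> \<sigma> = \<tau>"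
        by (elim ex1E) blast
      moreover have "inc (perm \<sigma> l) \<longleftrightarrow> (\<forall>i. Suc i < k \<longrightarrow> l (\<sigma> i) < l (\<sigma> (Suc i)))" for \<sigma>
        by (simp add: inc_def perm_def)
      ultimately have \<tau>: "{\<sigma>\<in>S. inc (perm \<sigma> l)} = {\<tau>}"
        by (simp add: S_def)
      have "(\<Sum>\<sigma>\<in>S. indicator {l. inc l} (perm \<sigma> l)) = (\<Sum>\<sigma>\<in>{\<sigma>\<in>S. inc (perm \<sigma> l)}. (1::ennreal))"
        by (intro sum.mono_neutral_cong_right) (auto simp: S_def finite_permutations)
      then show ?case by (simp add: \<tau>)
    qed
  qed
  have "(\<integral>\<^sup>+l. G l \<partial>?M) = (\<integral>\<^sup>+l. (\<Sum>\<sigma>\<in>S. indicator {l. inc l} (perm \<sigma> l)) * G l \<partial>?M)"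
    by (intro nn_integral_cong_AE) (use part in eventually_elim, simp)
  also have "\<dots> = (\<integral>\<^sup>+l. (\<Sum>\<sigma>\<in>S. indicator {l. inc l} (perm \<sigma> l) * G (perm \<sigma> l)) \<partial>?M)"
    by (simp add: sum_distrib_right G_perm)
  also have "\<dots> = (\<Sum>\<sigma>\<in>S. (\<integral>\<^sup>+l. indicator {l. inc l} (perm \<sigma> l) * G (perm \<sigma> l) \<partial>?M))"
  proof (intro nn_integral_sum)
    fix \<sigma> assume "\<sigma> \<in> S"
    note [measurable] = permM[OF this]
    show "(\<lambda>l. indicator {l. inc l} (perm \<sigma> l) * G (perm \<sigma> l)) \<in> borel_measurable ?M"
      by measurable
  qed
  also have "\<dots> = (\<Sum>\<sigma>\<in>S. (\<integral>\<^sup>+l. indicator {l. inc l} l * G l \<partial>?M))"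
  proof (intro sum.cong refl)
    fix \<sigma> assume \<sigma>: "\<sigma> \<in> S"
    have "distr ?M ?M (perm \<sigma>) = ?M"
      unfolding perm_def using \<sigma> by (intro distr_PiM_lborel_permutes) (auto simp: S_def)
    then have "(\<integral>\<^sup>+l. indicator {l. inc l} l * G l \<partial>?M) = (\<integral>\<^sup>+l. indicator {l. inc l} l * G l \<partial>distr ?M ?M (perm \<sigma>))"
      by simp
    also have "\<dots> = (\<integral>\<^sup>+l. indicator {l. inc l} (perm \<sigma> l) * G (perm \<sigma> l) \<partial>?M)"
      by (intro nn_integral_distr permM[OF \<sigma>]) measurable
    finally show "(\<integral>\<^sup>+l. indicator {l. inc l} (perm \<sigma> l) * G (perm \<sigma> l) \<partial>?M)
        = (\<integral>\<^sup>+l. indicator {l. inc l} l * G l \<partial>?M)" by simp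
  qed
  also have "\<dots> = fact k * (\<integral>\<^sup>+l. indicator {l. inc l} l * G l \<partial>?M)"
    by (simp add: S_def card_permutations)
  finally show ?thesis by (simp add: G_def inc_def)
qed

section \<open>Chains of transition densities\<close>

lemma measurable_stable_density [measurable (raw)]:
  fixes g :: "'n \<Rightarrow> 'a::euclidean_space"
  assumes [measurable]: "f \<in> borel_measurable N" "g \<in> borel_measurable N"
  shows "(\<lambda>n. stable_density \<alpha> (f n) (g n)) \<in> borel_measurable N"
  unfolding stable_density_def by measurable

lemma measurable_ptd [measurable (raw)]:
  fixes g h :: "'n \<Rightarrow> 'a::euclidean_space"
  assumes [measurable]: "f \<in> borel_measurable N" "g \<in> borel_measurable N" "h \<in> borel_measurable N"
  shows "(\<lambda>n. ptd \<alpha> (f n) (g n) (h n)) \<in> borel_measurable N"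
  unfolding ptd_def by measurable

lemma ptd_commute: "ptd \<alpha> t x y = ptd \<alpha> t y x"
proof -
  have "cos ((x - y) \<bullet> \<xi>) = cos ((y - x) \<bullet> \<xi>)" for \<xi>
    by (metis cos_minus inner_minus_left minus_diff_eq)
  then show ?thesis by (simp add: ptd_def stable_density_def)
qed

text \<open>The \<open>ennreal\<close> counterpart of \<^const>\<open>fdd_chain\<close> for a single set visited at all times, for which
  Tonelli's theorem needs no integrability side conditions.\<close>
fun nchain :: "real \<Rightarrow> 'a set \<Rightarrow> (real \<Rightarrow> 'a \<Rightarrow> ennreal) \<Rightarrow> real \<Rightarrow> 'a::euclidean_space \<Rightarrow> real list \<Rightarrow> ennreal"
where
  "nchain \<alpha> A g r z [] = g r z"
| "nchain \<alpha> A g r z (s # ss) =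
     (\<integral>\<^sup>+w. indicator A w * ennreal (ptd \<alpha> (s - r) z w) * nchain \<alpha> A g s w ss \<partial>lborel)"

text \<open>The times are functions \<open>s i\<close> of a parameter \<open>n\<close> over a fixed
  index list, so the length of the chain is constant while its entries vary. Measurability is needed
  jointly in parameter, time and position, because each step of the induction puts
  \<open>s i n\<close> for the time and the integration variable for the position.\<close>

lemma measurable_nchain_aux:
  fixes A :: "'a::euclidean_space set" and g :: "'n \<Rightarrow> real \<Rightarrow> 'a \<Rightarrow> ennreal"
  assumes [measurable]: "A \<in> sets borel"
    and g: "(\<lambda>(n, r, z). g n r z) \<in> borel_measurable (N \<Otimes>\<^sub>M borel \<Otimes>\<^sub>M borel)"
    and s: "\<And>i. i \<in> set is \<Longrightarrow> s i \<in> borel_measurable N"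
  shows "(\<lambda>(n, r, z). nchain \<alpha> A (g n) r z (map (\<lambda>i. s i n) is))
           \<in> borel_measurable (N \<Otimes>\<^sub>M borel \<Otimes>\<^sub>M borel)"
  using s
proof (induction "is")
  case Nil
  then show ?case using g by simp
next
  case (Cons i "is")
  then have [measurable]: "s i \<in> borel_measurable N" by simp
  from Cons have [measurable]:
    "(\<lambda>(n, r, z). nchain \<alpha> A (g n) r z (map (\<lambda>i. s i n) is)) \<in> borel_measurable (N \<Otimes>\<^sub>M borel \<Otimes>\<^sub>M borel)"
    by simp
  have "(\<lambda>x. (\<lambda>(n, r, z). nchain \<alpha> A (g n) r z (map (\<lambda>i. s i n) is))
      (fst (fst x), s i (fst (fst x)), snd x))
    \<in> borel_measurable ((N \<Otimes>\<^sub>M borel \<Otimes>\<^sub>M borel) \<Otimes>\<^sub>M borel)"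
    by measurable
  then have [measurable]: "(\<lambda>x. nchain \<alpha> A (g (fst (fst x))) (s i (fst (fst x))) (snd x)
      (map (\<lambda>i. s i (fst (fst x))) is))
    \<in> borel_measurable ((N \<Otimes>\<^sub>M borel \<Otimes>\<^sub>M borel) \<Otimes>\<^sub>M borel)"
    by simp
  have "(\<lambda>((n, r, z), w). indicator A w * ennreal (ptd \<alpha> (s i n - r) z w) *
        nchain \<alpha> A (g n) (s i n) w (map (\<lambda>i. s i n) is))
      \<in> borel_measurable ((N \<Otimes>\<^sub>M borel \<Otimes>\<^sub>M borel) \<Otimes>\<^sub>M lborel)"
    unfolding case_prod_beta by measurable
  from lborel.borel_measurable_nn_integral_fst[OF this] show ?case
    by (simp add: case_prod_beta)
qed

lemma measurable_nchain:
  fixes A :: "'a::euclidean_space set" and g :: "'n \<Rightarrow> real \<Rightarrow> 'a \<Rightarrow> ennreal"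
  assumes A: "A \<in> sets borel"
    and g: "(\<lambda>(n, r, z). g n r z) \<in> borel_measurable (N \<Otimes>\<^sub>M borel \<Otimes>\<^sub>M borel)"
    and s: "\<And>i. i \<in> set is \<Longrightarrow> s i \<in> borel_measurable N"
    and [measurable]: "r \<in> borel_measurable N" "z \<in> borel_measurable N"
  shows "(\<lambda>n. nchain \<alpha> A (g n) (r n) (z n) (map (\<lambda>i. s i n) is)) \<in> borel_measurable N"
proof -
  note [measurable] = measurable_nchain_aux[OF A g s]
  have "(\<lambda>n. (\<lambda>(n, r, z). nchain \<alpha> A (g n) r z (map (\<lambda>i. s i n) is)) (n, r n, z n)) \<in> borel_measurable N"
    by measurable
  then show ?thesis by simp
qed

lemma measurable_nchain_fixed:
  fixes A :: "'a::euclidean_space set"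
  assumes A: "A \<in> sets borel" and g: "case_prod g \<in> borel_measurable (borel \<Otimes>\<^sub>M borel)"
  shows "(\<lambda>z. nchain \<alpha> A g r z ss) \<in> borel_measurable borel"
proof -
  have "(\<lambda>(n :: 'a, r, z). g r z) = case_prod g \<circ> snd" by (simp add: fun_eq_iff split_beta)
  then have "(\<lambda>(n :: 'a, r, z). g r z) \<in> borel_measurable (borel \<Otimes>\<^sub>M borel \<Otimes>\<^sub>M borel)"
    using measurable_comp[OF measurable_snd g] by simp
  then have "(\<lambda>z. nchain \<alpha> A g r z (map (\<lambda>i. i) ss)) \<in> borel_measurable borel"
    by (intro measurable_nchain[OF A]) auto
  then show ?thesis by simp
qed

text \<open>By \<open>super\<close>, one more visit cannot raise the terminal weight, and
  restriction to \<open>A\<close> only lowers it further. The chain thus stays below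
  \<open>g r z\<close>, is finite, and passing between \<open>real\<close> and
  \<open>ennreal\<close> loses nothing. The weights of interest are the constant 1, for the process,
  and \<open>ptd \<alpha> (t - r) z y\<close>, for the bridge, where the horizon \<open>T\<close>
  keeps \<open>t - r\<close> positive.\<close>

lemma fdd_chain_eq_nchain:
  fixes A :: "'a::euclidean_space set" and g :: "real \<Rightarrow> 'a \<Rightarrow> real"
  assumes A [measurable]: "A \<in> sets borel"
    and g_meas: "case_prod g \<in> borel_measurable (borel \<Otimes>\<^sub>M borel)"
    and g_nonneg: "\<And>r z. 0 \<le> r \<Longrightarrow> r < T \<Longrightarrow> 0 \<le> g r z"
    and super: "\<And>r s z. 0 \<le> r \<Longrightarrow> r < s \<Longrightarrow> s < T \<Longrightarrow>
      (\<integral>\<^sup>+w. ennreal (ptd \<alpha> (s - r) z w) * ennreal (g s w) \<partial>lborel) \<le> ennreal (g r z)"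
    and pos: "\<And>t (x::'a) y. 0 < t \<Longrightarrow> 0 \<le> ptd \<alpha> t x y"
    and "0 \<le> r" "r < T" "sorted_wrt (<) (r # ss)" "\<forall>s\<in>set ss. s < T"
  shows "0 \<le> fdd_chain \<alpha> g r z (map (\<lambda>s. (s, A)) ss)
    \<and> ennreal (fdd_chain \<alpha> g r z (map (\<lambda>s. (s, A)) ss)) = nchain \<alpha> A (\<lambda>r z. ennreal (g r z)) r z ss
    \<and> nchain \<alpha> A (\<lambda>r z. ennreal (g r z)) r z ss \<le> ennreal (g r z)"
  using assms(6-)
proof (induction ss arbitrary: r z)
  case Nil
  then show ?case by (simp add: g_nonneg)
next
  case (Cons s ss)
  let ?g = "\<lambda>r z. ennreal (g r z)" and ?f = "\<lambda>w. fdd_chain \<alpha> g s w (map (\<lambda>s. (s, A)) ss)"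
  from Cons.prems have rs: "r < s" "s < T" "0 \<le> s" "sorted_wrt (<) (s # ss)" by auto
  note IH = Cons.IH[OF \<open>0 \<le> s\<close> \<open>s < T\<close> rs(4)]
  have p: "0 \<le> ptd \<alpha> (s - r) z w" for w using pos rs by simp
  have f: "0 \<le> ?f w" "ennreal (?f w) = nchain \<alpha> A ?g s w ss"
      "nchain \<alpha> A ?g s w ss \<le> ?g s w" for w
    using IH[of w] Cons.prems by auto
  have "case_prod ?g = (\<lambda>x. ennreal (case_prod g x))"
    by (simp add: fun_eq_iff split_beta)
  then have "case_prod ?g \<in> borel_measurable (borel \<Otimes>\<^sub>M borel)"
    using g_meas by simp
  note [measurable] = measurable_nchain_fixed[OF A this]
  have f_eq: "?f = (\<lambda>w. enn2real (nchain \<alpha> A ?g s w ss))"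
    by (simp add: f(1) flip: f(2))
  have [measurable]: "?f \<in> borel_measurable borel"
    unfolding f_eq by measurable
  \<comment> \<open>For nonnegative measurable functions this conversion holds even before
    integrability is known: if the integral is infinite, both sides are 0 by convention. Finiteness
    enters only afterwards, through \<open>le\<close>.\<close>
  have eq: "fdd_chain \<alpha> g r z (map (\<lambda>s. (s, A)) (s # ss)) = enn2real (nchain \<alpha> A ?g r z (s # ss))"
  proof -
    have "ennreal (indicator A w * ptd \<alpha> (s - r) z w * ?f w)
        = indicator A w * ennreal (ptd \<alpha> (s - r) z w) * nchain \<alpha> A ?g s w ss" for w
      using f(1)[of w] p[of w] by (simp add: ennreal_mult ennreal_indicator f(2))
    moreover have "(\<integral>w. indicator A w * ptd \<alpha> (s - r) z w * ?f w \<partial>lborel)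
        = enn2real (\<integral>\<^sup>+w. ennreal (indicator A w * ptd \<alpha> (s - r) z w * ?f w) \<partial>lborel)"
      using f(1) p by (intro integral_eq_nn_integral) auto
    ultimately show ?thesis by simp
  qed
  have "nchain \<alpha> A ?g r z (s # ss) \<le> (\<integral>\<^sup>+w. ennreal (ptd \<alpha> (s - r) z w) * ?g s w \<partial>lborel)"
    using f(3) by (auto intro!: nn_integral_mono mult_mono simp: indicator_def)
  also have "\<dots> \<le> ?g r z" using super Cons.prems rs by simp
  finally have le: "nchain \<alpha> A ?g r z (s # ss) \<le> ?g r z" .
  then have "nchain \<alpha> A ?g r z (s # ss) < \<infinity>"
    by (metis ennreal_less_top infinity_ennreal_def order_le_less_trans)
  then show ?case using le unfolding eq by (simp del: nchain.simps)
qed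

section \<open>Consequences of the laws of the process and its bridges for the density\<close>

text \<open>The process and the bridges may live on different sample spaces; what links them is the
  common density \<open>ptd \<alpha>\<close> in their finite-dimensional distributions.\<close>

locale stable_process_with_bridges =
  fixes \<alpha> :: real
    and P :: "'a::euclidean_space \<Rightarrow> 'w measure" and X :: "real \<Rightarrow> 'w \<Rightarrow> 'a"
    and B :: "real \<Rightarrow> 'a \<Rightarrow> 'a \<Rightarrow> 'v measure" and Y :: "real \<Rightarrow> 'v \<Rightarrow> 'a"
  assumes process: "is_stable_process \<alpha> P X"
    and bridge: "0 < t \<Longrightarrow> is_stable_bridge \<alpha> t x y (B t x y) Y"
begin

lemma prob_space_P: "prob_space (P x)"
  and measurable_X: "X s \<in> borel_measurable (P x)"
  and cadlag_X: "\<omega> \<in> space (P x) \<Longrightarrow> cadlag_on {0..} (\<lambda>s. X s \<omega>)"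
  and AE_X_0: "AE \<omega> in P x. X 0 \<omega> = x"
  and measure_X: "sorted_wrt (<) (map fst ss) \<Longrightarrow> \<forall>p\<in>set ss. 0 < fst p \<Longrightarrow>
     \<forall>p\<in>set ss. snd p \<in> sets borel \<Longrightarrow>
     measure (P x) {\<omega>\<in>space (P x). \<forall>p\<in>set ss. X (fst p) \<omega> \<in> snd p} = fdd_chain \<alpha> (\<lambda>_ _. 1) 0 x ss"
  using process unfolding is_stable_process_def by blast+

lemma
  assumes "0 < t"
  shows prob_space_B: "prob_space (B t x y)"
    and measurable_Y: "Y s \<in> borel_measurable (B t x y)"
    and cadlag_Y: "\<omega> \<in> space (B t x y) \<Longrightarrow> cadlag_on {0..t} (\<lambda>s. Y s \<omega>)"
    and measure_Y: "sorted_wrt (<) (map fst ss) \<Longrightarrow> \<forall>p\<in>set ss. 0 < fst p \<and> fst p < t \<Longrightarrow>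
     \<forall>p\<in>set ss. snd p \<in> sets borel \<Longrightarrow>
     measure (B t x y) {\<omega>\<in>space (B t x y). \<forall>p\<in>set ss. Y (fst p) \<omega> \<in> snd p}
       = fdd_chain \<alpha> (\<lambda>r z. ptd \<alpha> (t - r) z y) 0 x ss / ptd \<alpha> t x y"
  using bridge[OF assms, of x y] unfolding is_stable_bridge_def by blast+

lemma measure_X_single:
  assumes "0 < s" "A \<in> sets borel"
  shows "measure (P x) {\<omega>\<in>space (P x). X s \<omega> \<in> A} = (\<integral>w. indicator A w * ptd \<alpha> s x w \<partial>lborel)"
  using measure_X[of "[(s, A)]" x] assms by simp

lemma integral_ptd: "0 < s \<Longrightarrow> (\<integral>w. ptd \<alpha> s (x::'a) w \<partial>lborel) = 1"
  using measure_X_single[of s UNIV x] prob_space.prob_space[OF prob_space_P] by simp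

text \<open>A function that is not integrable has Bochner integral 0 by convention, whereas this
  integral is 1.\<close>

lemma integrable_ptd: "0 < s \<Longrightarrow> integrable lborel (ptd \<alpha> s (x::'a))"
  using integral_ptd[of s x] not_integrable_integral_eq by fastforce

text \<open>The integral of the density over the set where it is negative is a probability, hence
  nonnegative; being also nonpositive it vanishes, so that set is null.\<close>

lemma AE_ptd_nonneg:
  assumes "0 < s"
  shows "AE w in lborel. 0 \<le> ptd \<alpha> s (x::'a) w"
proof -
  let ?A = "{w. ptd \<alpha> s x w < 0}"
  let ?f = "\<lambda>w. - (indicator ?A w * ptd \<alpha> s x w)"
  have A: "?A \<in> sets borel" by measurable
  have f: "0 \<le> ?f w" for w by (auto simp: indicator_def)
  have "integrable lborel (\<lambda>w. indicator ?A w *\<^sub>R ptd \<alpha> s x w)"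
    using A integrable_ptd[OF assms] by (intro integrable_mult_indicator) simp
  then have int: "integrable lborel ?f"
    by (intro Bochner_Integration.integrable_minus) simp
  have "0 \<le> (\<integral>w. indicator ?A w * ptd \<alpha> s x w \<partial>lborel)"
    by (subst measure_X_single[OF assms A, symmetric]) simp
  moreover have "0 \<le> (\<integral>w. ?f w \<partial>lborel)" by (intro Bochner_Integration.integral_nonneg f)
  ultimately have "(\<integral>w. ?f w \<partial>lborel) = 0" by simp
  then have "AE w in lborel. ?f w = 0"
    using integral_nonneg_eq_0_iff_AE[OF int] f by simp
  then show ?thesis by eventually_elim (auto simp: indicator_def split: if_splits)
qed

text \<open>The bridge law has total mass one, whereas \<open>x / 0 = 0\<close>: so its normalisation yields both the
  Chapman-Kolmogorov identity and \<^term>\<open>ptd \<alpha> t x y \<noteq> 0\<close>.\<close>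
lemma bridge_normalisation:
  assumes "0 < s" "s < t"
  shows "ptd \<alpha> t (x::'a) y \<noteq> 0"
    and "(\<integral>w. ptd \<alpha> s x w * ptd \<alpha> (t - s) w y \<partial>lborel) = ptd \<alpha> t x y"
proof -
  have "1 = (\<integral>w. ptd \<alpha> s x w * ptd \<alpha> (t - s) w y \<partial>lborel) / ptd \<alpha> t x y"
    using measure_Y[of t "[(s, UNIV)]" x y] prob_space.prob_space[OF prob_space_B, of t x y] assms
    by simp
  then show "ptd \<alpha> t x y \<noteq> 0" "(\<integral>w. ptd \<alpha> s x w * ptd \<alpha> (t - s) w y \<partial>lborel) = ptd \<alpha> t x y"
    by (auto simp: field_simps split: if_splits)
qed

text \<open>The Chapman-Kolmogorov identity at time \<open>t / 2\<close> expresses the density as an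
  integral of a product of almost everywhere nonnegative functions, which upgrades the almost
  everywhere sign to every point. Symmetry makes the second factor accessible, and the value 0 is
  excluded by \<open>bridge_normalisation\<close>.\<close>

lemma ptd_pos:
  assumes "0 < t"
  shows "0 < ptd \<alpha> t (x::'a) y"
proof -
  have "AE w in lborel. 0 \<le> ptd \<alpha> (t / 2) x w * ptd \<alpha> (t - t / 2) w y"
    using AE_ptd_nonneg[of "t / 2" x] AE_ptd_nonneg[of "t / 2" y] assms
    by (auto simp: ptd_commute[of _ _ _ y])
  then have "0 \<le> (\<integral>w. ptd \<alpha> (t / 2) x w * ptd \<alpha> (t - t / 2) w y \<partial>lborel)"
    by (rule integral_nonneg_AE)
  then show ?thesis
    using bridge_normalisation[of "t / 2" t x y] assms by simp
qed

lemma ptd_nonneg: "0 < t \<Longrightarrow> 0 \<le> ptd \<alpha> t (x::'a) y"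
  using ptd_pos by (rule less_imp_le)

lemma nn_integral_ptd: "0 < s \<Longrightarrow> (\<integral>\<^sup>+w. ennreal (ptd \<alpha> s (x::'a) w) \<partial>lborel) = 1"
  using nn_integral_eq_integral[OF integrable_ptd] by (simp add: ptd_nonneg integral_ptd)

lemma nn_integral_ptd': "0 < s \<Longrightarrow> (\<integral>\<^sup>+x. ennreal (ptd \<alpha> s x (y::'a)) \<partial>lborel) = 1"
  using nn_integral_ptd[of s y] by (simp add: ptd_commute[of _ _ _ y])

text \<open>Integrability is read off from the value: the Bochner integral equals
  \<open>ptd \<alpha> t x y\<close>, which is nonzero, so it is not the default value.\<close>

lemma chapman_kolmogorov:
  assumes "0 < s" "s < t"
  shows "(\<integral>\<^sup>+w. ennreal (ptd \<alpha> s (x::'a) w) * ennreal (ptd \<alpha> (t - s) w y) \<partial>lborel) = ennreal (ptd \<alpha> t x y)"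
proof -
  have "integrable lborel (\<lambda>w. ptd \<alpha> s x w * ptd \<alpha> (t - s) w y)"
    using bridge_normalisation[OF assms, of x y] not_integrable_integral_eq by fastforce
  then show ?thesis
    using assms by (simp add: nn_integral_eq_integral ptd_nonneg bridge_normalisation(2) flip: ennreal_mult)
qed

lemma nchain_one_le_1:
  fixes A :: "'a set"
  assumes "A \<in> sets borel" "0 \<le> r" "sorted_wrt (<) (r # ss)"
  shows "nchain \<alpha> A (\<lambda>_ _. 1) r z ss \<le> 1"
    and "0 \<le> fdd_chain \<alpha> (\<lambda>_ _. 1) r z (map (\<lambda>s. (s, A)) ss)"
    and "ennreal (fdd_chain \<alpha> (\<lambda>_ _. 1) r z (map (\<lambda>s. (s, A)) ss)) = nchain \<alpha> A (\<lambda>_ _. 1) r z ss"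
proof -
  \<comment> \<open>With constant weight any horizon beyond all the times will do.\<close>
  define T where "T = Max (set (r # ss)) + 1"
  have T: "s < T" if "s \<in> set (r # ss)" for s
    using Max_ge[OF _ that] by (simp add: T_def)
  have "0 \<le> fdd_chain \<alpha> (\<lambda>_ _. 1) r z (map (\<lambda>s. (s, A)) ss)
    \<and> ennreal (fdd_chain \<alpha> (\<lambda>_ _. 1) r z (map (\<lambda>s. (s, A)) ss)) = nchain \<alpha> A (\<lambda>r z. ennreal 1) r z ss
    \<and> nchain \<alpha> A (\<lambda>r z. ennreal 1) r z ss \<le> ennreal 1"
    by (rule fdd_chain_eq_nchain[where T = T])
       (use assms T nn_integral_ptd in \<open>auto simp: ptd_nonneg\<close>)
  then show "nchain \<alpha> A (\<lambda>_ _. 1) r z ss \<le> 1"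
    "0 \<le> fdd_chain \<alpha> (\<lambda>_ _. 1) r z (map (\<lambda>s. (s, A)) ss)"
    "ennreal (fdd_chain \<alpha> (\<lambda>_ _. 1) r z (map (\<lambda>s. (s, A)) ss)) = nchain \<alpha> A (\<lambda>_ _. 1) r z ss"
    by simp_all
qed

lemma emeasure_X_chain:
  fixes A :: "'a set"
  assumes A: "A \<in> sets borel" and ss: "sorted_wrt (<) (0 # ss)"
  shows "emeasure (P x) {\<omega>\<in>space (P x). \<forall>s\<in>set ss. X s \<omega> \<in> A} = nchain \<alpha> A (\<lambda>_ _. 1) 0 x ss"
proof -
  interpret prob_space "P x" by (rule prob_space_P)
  have "measure (P x) {\<omega>\<in>space (P x). \<forall>s\<in>set ss. X s \<omega> \<in> A}
      = fdd_chain \<alpha> (\<lambda>_ _. 1) 0 x (map (\<lambda>s. (s, A)) ss)"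
    using measure_X[of "map (\<lambda>s. (s, A)) ss" x] assms by (auto simp: comp_def)
  then show ?thesis
    using nchain_one_le_1(3)[OF A _ ss, of x] by (simp add: emeasure_eq_measure)
qed

text \<open>The terminal weight is the density of the last jump to \<open>y\<close>, for which
  Chapman-Kolmogorov supplies the supersolution hypothesis of \<open>fdd_chain_eq_nchain\<close>.
  The factor \<open>ptd \<alpha> t x y\<close> cancels the normalisation of the bridge.\<close>

lemma emeasure_Y_chain:
  fixes A :: "'a set"
  assumes A: "A \<in> sets borel" and ss: "sorted_wrt (<) (0 # ss)" "\<forall>s\<in>set ss. s < t" and t: "0 < t"
  shows "ennreal (ptd \<alpha> t x y) * emeasure (B t x y) {\<omega>\<in>space (B t x y). \<forall>s\<in>set ss. Y s \<omega> \<in> A}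
      = nchain \<alpha> A (\<lambda>r z. ennreal (ptd \<alpha> (t - r) z y)) 0 x ss"
proof -
  interpret prob_space "B t x y" using t by (rule prob_space_B)
  let ?g = "\<lambda>r z. ptd \<alpha> (t - r) z y"
  have "ennreal (fdd_chain \<alpha> ?g 0 x (map (\<lambda>s. (s, A)) ss)) = nchain \<alpha> A (\<lambda>r z. ennreal (?g r z)) 0 x ss"
  proof -
    have "case_prod ?g \<in> borel_measurable (borel \<Otimes>\<^sub>M borel)"
      unfolding case_prod_beta by measurable
    moreover have "(\<integral>\<^sup>+w. ennreal (ptd \<alpha> (s - r) z w) * ennreal (?g s w) \<partial>lborel) \<le> ennreal (?g r z)"
      if "0 \<le> r" "r < s" "s < t" for r s z
      using chapman_kolmogorov[of "s - r" "t - r" z y] that by simp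
    ultimately show ?thesis
      using fdd_chain_eq_nchain[of A ?g t \<alpha> 0 ss x] ptd_nonneg ss t A by auto
  qed
  moreover have "measure (B t x y) {\<omega>\<in>space (B t x y). \<forall>s\<in>set ss. Y s \<omega> \<in> A}
      = fdd_chain \<alpha> ?g 0 x (map (\<lambda>s. (s, A)) ss) / ptd \<alpha> t x y"
    using measure_Y[OF t, of "map (\<lambda>s. (s, A)) ss" x y] assms by (auto simp: comp_def)
  then have "ptd \<alpha> t x y * measure (B t x y) {\<omega>\<in>space (B t x y). \<forall>s\<in>set ss. Y s \<omega> \<in> A}
      = fdd_chain \<alpha> ?g 0 x (map (\<lambda>s. (s, A)) ss)"
    using ptd_pos[OF t, of x y] by simp
  ultimately show ?thesis
    using ptd_nonneg[OF t, of x y] by (simp add: emeasure_eq_measure flip: ennreal_mult)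
qed

text \<open>The end point \<open>y\<close> occurs only in the last density. Tonelli's theorem moves
  its integral inwards past one visit at a time, until it meets that density and gives 1.\<close>

lemma nn_integral_nchain_terminal:
  fixes A :: "'a set"
  assumes A [measurable]: "A \<in> sets borel"
    and "sorted_wrt (<) (r # ss)" "\<forall>s\<in>set (r # ss). s < t"
  shows "(\<integral>\<^sup>+y. nchain \<alpha> A (\<lambda>r z. ennreal (ptd \<alpha> (t - r) z y)) r z ss \<partial>lborel)
      = nchain \<alpha> A (\<lambda>_ _. 1) r z ss"
  using assms(2-)
proof (induction ss arbitrary: r z)
  case Nil
  then show ?case by (simp add: nn_integral_ptd)
next
  case (Cons s ss)
  let ?g = "\<lambda>y r z. ennreal (ptd \<alpha> (t - r) z y)"
  have [measurable]: "(\<lambda>x :: 'a \<times> 'a. nchain \<alpha> A (?g (snd x)) s (fst x) ss) \<in> borel_measurable (borel \<Otimes>\<^sub>M borel)"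
  proof -
    have "(\<lambda>(x :: 'a \<times> 'a, r, z). ?g (snd x) r z) \<in> borel_measurable ((borel \<Otimes>\<^sub>M borel) \<Otimes>\<^sub>M borel \<Otimes>\<^sub>M borel)"
      unfolding case_prod_beta by measurable
    then have "(\<lambda>x :: 'a \<times> 'a. nchain \<alpha> A (?g (snd x)) s (fst x) (map (\<lambda>i. i) ss)) \<in> borel_measurable (borel \<Otimes>\<^sub>M borel)"
      by (intro measurable_nchain[OF A]) auto
    then show ?thesis by simp
  qed
  have "(\<integral>\<^sup>+y. nchain \<alpha> A (?g y) r z (s # ss) \<partial>lborel)
     = (\<integral>\<^sup>+w. (\<integral>\<^sup>+y. indicator A w * ennreal (ptd \<alpha> (s - r) z w) * nchain \<alpha> A (?g y) s w ss \<partial>lborel) \<partial>lborel)"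
    unfolding nchain.simps
    by (rule lborel_pair.Fubini') (unfold case_prod_beta, measurable)
  also have "\<dots> = (\<integral>\<^sup>+w. indicator A w * ennreal (ptd \<alpha> (s - r) z w) * nchain \<alpha> A (\<lambda>_ _. 1) s w ss \<partial>lborel)"
  proof (intro nn_integral_cong)
    fix w
    have [measurable]: "(\<lambda>y. nchain \<alpha> A (?g y) s w ss) \<in> borel_measurable borel"
      using measurable_compose[of "\<lambda>y. (w, y)", OF _ \<open>(\<lambda>x. nchain \<alpha> A (?g (snd x)) s (fst x) ss) \<in> _\<close>]
      by simp
    show "(\<integral>\<^sup>+y. indicator A w * ennreal (ptd \<alpha> (s - r) z w) * nchain \<alpha> A (?g y) s w ss \<partial>lborel)
        = indicator A w * ennreal (ptd \<alpha> (s - r) z w) * nchain \<alpha> A (\<lambda>_ _. 1) s w ss"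
      using Cons by (subst nn_integral_cmult) auto
  qed
  finally show ?case by simp
qed

text \<open>The starting point occurs only in the first density, which by symmetry also has unit
  mass in its first argument. In other words, Lebesgue measure is invariant for the process.\<close>

lemma nn_integral_nchain_initial:
  fixes A :: "'a set"
  assumes A [measurable]: "A \<in> sets borel" and "r < s"
  shows "(\<integral>\<^sup>+x. nchain \<alpha> A (\<lambda>_ _. 1) r x (s # ss) \<partial>lborel)
      = (\<integral>\<^sup>+w. indicator A w * nchain \<alpha> A (\<lambda>_ _. 1) s w ss \<partial>lborel)"
proof -
  have [measurable]: "(\<lambda>w. nchain \<alpha> A (\<lambda>_ _. 1) s w ss) \<in> borel_measurable borel"
    by (rule measurable_nchain_fixed[OF A]) simp
  have "(\<integral>\<^sup>+x. nchain \<alpha> A (\<lambda>_ _. 1) r x (s # ss) \<partial>lborel)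
     = (\<integral>\<^sup>+w. (\<integral>\<^sup>+x. indicator A w * ennreal (ptd \<alpha> (s - r) x w) * nchain \<alpha> A (\<lambda>_ _. 1) s w ss \<partial>lborel) \<partial>lborel)"
    unfolding nchain.simps
    by (rule lborel_pair.Fubini') (unfold case_prod_beta, measurable)
  also have "\<dots> = (\<integral>\<^sup>+w. indicator A w * nchain \<alpha> A (\<lambda>_ _. 1) s w ss \<partial>lborel)"
    using \<open>r < s\<close> by (simp add: nn_integral_multc nn_integral_cmult nn_integral_ptd')
  finally show ?thesis .
qed

end

text \<open>Only differences of times enter the densities, and the weight is constant.\<close>

lemma nchain_shift:
  "nchain \<alpha> A (\<lambda>_ _. 1) (r + c) z (map (\<lambda>s. s + c) ss) = nchain \<alpha> A (\<lambda>_ _. 1) r z ss"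
  by (induction ss arbitrary: r z) simp_all

section \<open>Moments of the occupation time\<close>

text \<open>Every subset of the exceptional null set is measurable for the completion, so
  \<open>f\<close> inherits measurability from \<open>g\<close>. Integrands built from the merely
  Lebesgue measurable \<Omega> can thereby be exchanged for Borel ones.\<close>

lemma integral_completion_AE_eq:
  fixes f g :: "'b \<Rightarrow> 'c::{banach, second_countable_topology}"
  assumes g: "g \<in> borel_measurable M" and eq: "AE x in M. f x = g x"
  shows "integral\<^sup>L (completion M) f = integral\<^sup>L M g"
proof -
  obtain N where N: "\<And>x. x \<in> space M - N \<Longrightarrow> f x = g x" "N \<in> null_sets M"
    using AE_E3[OF eq] by blast
  have "f \<in> borel_measurable (completion M)"
  proof (rule measurableI)
    fix S :: "'c set" assume S: "S \<in> sets borel"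
    have "f -` S \<inter> space M = (g -` S \<inter> space M - N) \<union> (f -` S \<inter> space M \<inter> N)"
      using N(1) by auto
    moreover have "g -` S \<inter> space M - N \<in> sets (completion M)"
      using measurable_sets[OF g S] N(2) by auto
    moreover have "f -` S \<inter> space M \<inter> N \<in> sets (completion M)"
      using null_sets_completion_subset[OF _ null_sets_completionI[OF N(2)], of "f -` S \<inter> space M \<inter> N"]
      by (auto dest: null_setsD2)
    ultimately show "f -` S \<inter> space (completion M) \<in> sets (completion M)"
      by (metis sets.Un space_completion)
  qed simp
  then have "integral\<^sup>L (completion M) f = integral\<^sup>L (completion M) g"
    using g AE_completion[OF eq] by (intro integral_cong_AE) (auto intro: measurable_completion)
  then show ?thesis using integral_completion[OF g] by simp
qed

text \<open>The passage from the Bochner integrals of the definitions to integrals in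
  \<open>ennreal\<close>; finiteness almost everywhere ensures that \<open>enn2real\<close> discards
  no mass.\<close>

lemma integral_lebesgue_enn2real:
  fixes f :: "'a::euclidean_space \<Rightarrow> real" and F :: "'a \<Rightarrow> ennreal"
  assumes F: "F \<in> borel_measurable borel"
    and eq: "AE x in lborel. f x = enn2real (F x)" and fin: "AE x in lborel. F x < \<infinity>"
  shows "(\<integral>x. f x \<partial>lebesgue) = enn2real (\<integral>\<^sup>+x. F x \<partial>lborel)"
proof -
  have "(\<integral>x. f x \<partial>lebesgue) = (\<integral>x. enn2real (F x) \<partial>lborel)"
    using F eq by (intro integral_completion_AE_eq) auto
  also have "\<dots> = enn2real (\<integral>\<^sup>+x. ennreal (enn2real (F x)) \<partial>lborel)"
    using F by (intro integral_eq_nn_integral) auto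
  also have "(\<integral>\<^sup>+x. ennreal (enn2real (F x)) \<partial>lborel) = (\<integral>\<^sup>+x. F x \<partial>lborel)"
    using fin by (intro nn_integral_cong_AE) (auto elim!: eventually_mono)
  finally show ?thesis .
qed

text \<open>The process is the pointwise limit of processes sampled at grid times to the right of
  \<open>s\<close>. Each of these uses only countably many times and is therefore jointly
  measurable.\<close>

lemma measurable_right_continuous_process:
  fixes Z :: "real \<Rightarrow> 'w \<Rightarrow> 'a::euclidean_space"
  assumes Z: "\<And>s. Z s \<in> borel_measurable M"
    and lim: "\<And>\<omega> s. \<omega> \<in> space M \<Longrightarrow> s \<in> {0..t} \<Longrightarrow> ((\<lambda>s. Z s \<omega>) \<longlongrightarrow> Z s \<omega>) (at_right s)"
  shows "(\<lambda>(s, \<omega>). if s \<in> {0..t} then Z s \<omega> else 0) \<in> borel_measurable (borel \<Otimes>\<^sub>M M)"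
proof -
  \<comment> \<open>The first point of the grid of mesh \<open>1 / Suc n\<close> lying strictly to
    the right of \<open>s\<close>; strictness is what the filter \<open>at_right s\<close>
    demands.\<close>
  define u where "u n s = real_of_int (\<lfloor>s * Suc n\<rfloor> + 1) / Suc n" for n and s :: real
  have u: "s < u n s" "u n s \<le> s + 1 / Suc n" for n s
  proof -
    have "s * Suc n < real_of_int (\<lfloor>s * Suc n\<rfloor> + 1)" by linarith
    then show "s < u n s" unfolding u_def by (simp add: pos_less_divide_eq)
    have "real_of_int (\<lfloor>s * Suc n\<rfloor> + 1) \<le> s * Suc n + 1" by linarith
    also have "\<dots> = (s + 1 / Suc n) * Suc n" by (simp add: field_simps)
    finally show "u n s \<le> s + 1 / Suc n" unfolding u_def by (simp add: pos_divide_le_eq)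
  qed
  have u_lim: "filterlim (\<lambda>n. u n s) (at_right s) sequentially" for s
  proof -
    have "(\<lambda>n. s + 1 / Suc n) \<longlonglongrightarrow> s + 0"
      by (intro tendsto_add tendsto_const lim_inverse_n'[THEN LIMSEQ_Suc])
    then have "(\<lambda>n. u n s) \<longlonglongrightarrow> s"
      using u by (intro tendsto_sandwich[of "\<lambda>_. s" "\<lambda>n. u n s" _ "\<lambda>n. s + 1 / Suc n"])
        (auto intro!: always_eventually less_imp_le)
    moreover have "u n s \<noteq> s" for n using u(1)[of s n] by simp
    ultimately show ?thesis
      unfolding filterlim_at using u(1)[of s] by (auto intro!: always_eventually)
  qed
  define f where "f n = (\<lambda>x. if fst x \<in> {0..t} then Z (u n (fst x)) (snd x) else 0)" for n
  have "(\<lambda>x. if fst x \<in> {0..t} then Z (fst x) (snd x) else 0) \<in> borel_measurable (borel \<Otimes>\<^sub>M M)"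
  proof (rule borel_measurable_LIMSEQ_metric)
    fix n
    \<comment> \<open>The time enters only through an integer, so the map is pieced together from
      countably many measurable ones.\<close>
    have "(\<lambda>x. Z (real_of_int (\<lfloor>fst x * real (Suc n)\<rfloor> + 1) / Suc n) (snd x)) \<in> borel_measurable (borel \<Otimes>\<^sub>M M)"
      by (rule measurable_compose_countable[where g = "\<lambda>x :: real \<times> 'w. \<lfloor>fst x * real (Suc n)\<rfloor>"
          and f = "\<lambda>j x. Z (real_of_int (j + 1) / Suc n) (snd x)"])
         (auto intro: measurable_compose[OF measurable_snd Z])
    then have [measurable]: "(\<lambda>x. Z (u n (fst x)) (snd x)) \<in> borel_measurable (borel \<Otimes>\<^sub>M M)"
      unfolding u_def .
    show "f n \<in> borel_measurable (borel \<Otimes>\<^sub>M M)"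
      unfolding f_def by measurable
  next
    fix x :: "real \<times> 'w" assume x: "x \<in> space (borel \<Otimes>\<^sub>M M)"
    show "(\<lambda>n. f n x) \<longlonglongrightarrow> (if fst x \<in> {0..t} then Z (fst x) (snd x) else 0)"
    proof (cases "fst x \<in> {0..t}")
      case True
      then show ?thesis
        using filterlim_compose[OF lim u_lim, of "snd x" "fst x"] x
        by (auto simp: f_def space_pair_measure)
    next
      case False
      then show ?thesis unfolding f_def if_not_P[OF False] by simp
    qed
  qed
  then show ?thesis by (simp add: case_prod_beta)
qed

text \<open>The times spent in \<open>A - \<Omega>\<close> form a null set. Hence the times spent in
  \<Omega> form a Lebesgue measurable set, of the same measure as the Borel set of times spent in
  \<open>A\<close>.\<close>

lemma occupation_cong:
  assumes "A \<in> sets borel" "\<Omega> \<subseteq> A"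
    and Z: "(\<lambda>s. if s \<in> {0..t} then Z s \<omega> else 0) \<in> borel_measurable borel"
    and AE: "AE s in lborel. s \<in> {0..t} \<longrightarrow> Z s \<omega> \<notin> A - \<Omega>"
  shows "occupation \<Omega> Z t \<omega> = measure lborel {s\<in>{0..t}. Z s \<omega> \<in> A}"
proof -
  let ?S = "\<lambda>D. {s\<in>{0..t}. Z s \<omega> \<in> D}"
  note [measurable] = Z assms(1)
  have "?S A = {s. s \<in> {0..t} \<and> (if s \<in> {0..t} then Z s \<omega> else 0) \<in> A}" by auto
  also have "\<dots> \<in> sets borel" by measurable
  finally have SA: "?S A \<in> sets lborel" by simp
  have "?S (A - \<Omega>) \<in> null_sets lebesgue"
  proof -
    obtain N where "\<And>s. s \<in> space lborel - N \<Longrightarrow> s \<in> {0..t} \<longrightarrow> Z s \<omega> \<notin> A - \<Omega>" "N \<in> null_sets lborel"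
      using AE_E3[OF AE] by blast
    then show ?thesis
      by (intro null_sets_completion_subset[OF _ null_sets_completionI[of N]]) auto
  qed
  moreover have "?S \<Omega> = ?S A - ?S (A - \<Omega>)" using assms(2) by auto
  ultimately have SO: "?S \<Omega> \<in> sets lebesgue" "emeasure lebesgue (?S \<Omega>) = emeasure lebesgue (?S A)"
    using SA by (auto simp: emeasure_Diff_null_set)
  have "occupation \<Omega> Z t \<omega> = (\<integral>s. indicator (?S \<Omega>) s \<partial>lebesgue)"
    unfolding occupation_def set_lebesgue_integral_def
    by (intro Bochner_Integration.integral_cong) (auto simp: indicator_def)
  also have "\<dots> = measure lebesgue (?S \<Omega>)" by simp
  also have "\<dots> = measure lborel (?S A)"
    using SO SA by (simp add: measure_def)
  finally show ?thesis .
qed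

lemma measurable_simplex_I [measurable]: "simplex_I k \<in> sets (PiM {..<k} (\<lambda>_. lborel))"
proof -
  let ?M = "PiM {..<k} (\<lambda>_. lborel :: real measure)"
  have "simplex_I k = {l \<in> space ?M. (\<forall>i\<in>{..<k}. 0 < l i \<and> l i < 1) \<and> (\<forall>i\<in>{i. Suc i < k}. l i < l (Suc i))}"
    by (auto simp: simplex_I_def space_PiM)
  moreover have "finite {i. Suc i < k}" by (rule finite_subset[of _ "{..<k}"]) auto
  ultimately show ?thesis
    by (auto intro!: sets.sets_Collect_conj sets.sets_Collect_finite_All' borel_measurable_less
        pred_intros_finite simp: pred_def[symmetric])
qed

lemma simplex_I_sorted:
  assumes l: "l \<in> simplex_I k" and t: "0 < t"
  shows "sorted_wrt (<) (0 # map (\<lambda>i. t * l i) [0..<k])" "\<forall>s\<in>set (map (\<lambda>i. t * l i) [0..<k]). s < t"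
proof -
  have "sorted_wrt (<) (map (\<lambda>i. t * l i) [0..<k])"
    using l t by (subst sorted_wrt_iff_nth_Suc_transp) (auto simp: transp_on_def simplex_I_def)
  then show "sorted_wrt (<) (0 # map (\<lambda>i. t * l i) [0..<k])"
    using l t by (auto simp: simplex_I_def)
  show "\<forall>s\<in>set (map (\<lambda>i. t * l i) [0..<k]). s < t"
    using l t by (auto simp: simplex_I_def)
qed

text \<open>Symmetrisation applied to the indicator of the open unit interval: the cube of volume 1
  consists of \<open>fact k\<close> copies of the simplex.\<close>

lemma emeasure_simplex_I: "fact k * emeasure (PiM {..<k} (\<lambda>_. lborel)) (simplex_I k) = 1"
proof -
  let ?M = "PiM {..<k} (\<lambda>_. lborel :: real measure)" and ?g = "indicator {0<..<1::real} :: real \<Rightarrow> ennreal"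
  have "emeasure ?M (simplex_I k)
      = (\<integral>\<^sup>+l. indicator {l. \<forall>i. Suc i < k \<longrightarrow> l i < l (Suc i)} l * (\<Prod>i<k. ?g (l i)) \<partial>?M)"
    unfolding nn_integral_indicator[OF measurable_simplex_I, symmetric]
    by (intro nn_integral_cong)
       (auto simp: simplex_I_def indicator_def space_PiM prod_zero_iff intro!: prod.neutral)
  moreover have "(\<integral>\<^sup>+l. (\<Prod>i<k. ?g (l i)) \<partial>?M) = (\<Prod>i<k. 1)"
    by (subst lborel_PiM.product_nn_integral_prod) auto
  ultimately show ?thesis
    by (subst (asm) nn_integral_PiM_prod_eq_fact_increasing) auto
qed

section \<open>Powers of the occupation time of the bridge\<close>

context stable_process_with_bridges
begin

lemma bridge_jointly_measurable:
  assumes "0 < t"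
  shows "(\<lambda>(s, \<omega>). if s \<in> {0..t} then Y s \<omega> else 0) \<in> borel_measurable (borel \<Otimes>\<^sub>M B t x y)"
  using measurable_Y[OF assms] cadlag_Y[OF assms]
  by (intro measurable_right_continuous_process) (auto simp: cadlag_on_def)

text \<open>At each fixed time strictly between 0 and \<open>t\<close> the bridge has a density, so
  it almost surely avoids \<open>N\<close>. Fubini's theorem turns this into a statement about
  almost every time along almost every path.\<close>

lemma bridge_avoids_null_set:
  assumes t: "0 < t" and N: "N \<in> null_sets lborel"
  shows "AE \<omega> in B t x y. AE s in lborel. s \<in> {0..t} \<longrightarrow> Y s \<omega> \<notin> N"
proof -
  interpret prob_space "B t x y" using t by (rule prob_space_B)
  interpret pair_sigma_finite lborel "B t x y" by standard
  define Z where "Z = (\<lambda>(s, \<omega>). if s \<in> {0..t} then Y s \<omega> else 0)"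
  have [measurable]: "Z \<in> borel_measurable (borel \<Otimes>\<^sub>M B t x y)"
    unfolding Z_def using bridge_jointly_measurable[OF t] .
  have Nb[measurable]: "N \<in> sets borel" using N by (auto dest: null_setsD2)
  have "AE s in lborel. AE \<omega> in B t x y. s \<in> {0<..<t} \<longrightarrow> Z (s, \<omega>) \<notin> N"
  proof (rule AE_I2)
    fix s
    show "AE \<omega> in B t x y. s \<in> {0<..<t} \<longrightarrow> Z (s, \<omega>) \<notin> N"
    proof (cases "s \<in> {0<..<t}")
      case True
      note [measurable] = measurable_Y[OF t, of s]
      have "ennreal (ptd \<alpha> t x y) * emeasure (B t x y) {\<omega>\<in>space (B t x y). Y s \<omega> \<in> N}
          = (\<integral>\<^sup>+w. indicator N w * (ennreal (ptd \<alpha> s x w) * ennreal (ptd \<alpha> (t - s) w y)) \<partial>lborel)"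
        using emeasure_Y_chain[OF Nb, of "[s]" t x y] True t by (simp add: mult.assoc)
      also have "\<dots> = (\<integral>\<^sup>+(w::'a). 0 \<partial>lborel)"
      proof (intro nn_integral_cong_AE)
        show "AE w in lborel. indicator N w * (ennreal (ptd \<alpha> s x w) * ennreal (ptd \<alpha> (t - s) w y)) = 0"
          using AE_not_in[OF N] by eventually_elim simp
      qed
      finally have "emeasure (B t x y) {\<omega>\<in>space (B t x y). Y s \<omega> \<in> N} = 0"
        using ptd_pos[OF t, of x y] by (simp add: ennreal_eq_0_iff not_le)
      then have "AE \<omega> in B t x y. Y s \<omega> \<notin> N"
        by (intro AE_I'[of "{\<omega>\<in>space (B t x y). Y s \<omega> \<in> N}"]) (auto simp: null_sets_def)
      then show ?thesis using True by (auto simp: Z_def)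
    qed auto
  qed
  moreover have "Measurable.pred (lborel \<Otimes>\<^sub>M B t x y) (\<lambda>x. fst x \<in> {0<..<t} \<longrightarrow> Z (fst x, snd x) \<notin> N)"
    by measurable
  ultimately have "AE \<omega> in B t x y. AE s in lborel. s \<in> {0<..<t} \<longrightarrow> Z (s, \<omega>) \<notin> N"
    using AE_commute[of "\<lambda>s \<omega>. s \<in> {0<..<t} \<longrightarrow> Z (s, \<omega>) \<notin> N"] by (simp add: pred_def)
  then show ?thesis
  proof eventually_elim
    case (elim \<omega>)
    \<comment> \<open>The finite-dimensional distributions do not describe the times 0 and
      \<open>t\<close>, but two points form a null set.\<close>
    have "AE s in lborel. s \<noteq> 0 \<and> s \<noteq> t" by (simp add: AE_lborel_singleton)
    then show ?case using elim by eventually_elim (auto simp: Z_def)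
  qed
qed

text \<open>After rescaling time to the unit interval, the occupation time is \<open>t\<close> times
  the integral of an indicator. Its power is an integral over the cube, which symmetrisation reduces
  to the simplex. Exchanging expectation and time integral leaves the probabilities that the bridge
  is in \<open>A\<close> at given increasing times, and these are chains.\<close>

lemma bridge_occupation_moment:
  assumes t: "0 < t" and A: "A \<in> sets borel" "\<Omega> \<subseteq> A" and null: "A - \<Omega> \<in> null_sets lebesgue"
  shows "ptd \<alpha> t x y * (\<integral>\<omega>. (occupation \<Omega> Y t \<omega>) ^ k \<partial>completion (B t x y))
    = enn2real (fact k * ennreal (t ^ k) * (\<integral>\<^sup>+l. indicator (simplex_I k) l *
        nchain \<alpha> A (\<lambda>r z. ennreal (ptd \<alpha> (t - r) z y)) 0 x (map (\<lambda>i. t * l i) [0..<k])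
          \<partial>PiM {..<k} (\<lambda>_. lborel)))"
proof -
  let ?M = "PiM {..<k} (\<lambda>_. lborel :: real measure)"
  interpret prob_space "B t x y" using t by (rule prob_space_B)
  interpret M: sigma_finite_measure ?M by (rule lborel_PiM.sigma_finite) simp
  interpret pair_sigma_finite ?M "B t x y" by standard
  note [measurable] = A(1)
  define Z where "Z = (\<lambda>(s, \<omega>). if s \<in> {0..t} then Y s \<omega> else 0)"
  have Z[measurable]: "Z \<in> borel_measurable (borel \<Otimes>\<^sub>M B t x y)"
    unfolding Z_def using bridge_jointly_measurable[OF t] .
  \<comment> \<open>The interval is open to match \<open>simplex_I\<close>; its end points
    contribute nothing to the integral.\<close>
  define g :: "'v \<Rightarrow> real \<Rightarrow> ennreal"
    where "g \<omega> \<theta> = indicator {0<..<1} \<theta> * indicator A (Z (t * \<theta>, \<omega>))" for \<omega> \<theta>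
  have g_meas2: "(\<lambda>x. g (snd x) (fst x i)) \<in> borel_measurable (?M \<Otimes>\<^sub>M B t x y)" if "i < k" for i
  proof -
    have [measurable]: "(\<lambda>x. fst x i) \<in> borel_measurable (?M \<Otimes>\<^sub>M B t x y)"
      using that measurable_compose[OF measurable_fst measurable_component_singleton[of i "{..<k}"]] by simp
    show ?thesis unfolding g_def by measurable
  qed
  have g_meas1[measurable]: "g \<omega> \<in> borel_measurable borel" if "\<omega> \<in> space (B t x y)" for \<omega>
    unfolding g_def using that by measurable
  define G where "G \<omega> = (\<integral>\<^sup>+\<theta>. g \<omega> \<theta> \<partial>lborel)" for \<omega>
  have [measurable]: "G \<in> borel_measurable (B t x y)"
  proof -
    have [measurable]: "(\<lambda>x. g (fst x) (snd x)) \<in> borel_measurable (B t x y \<Otimes>\<^sub>M borel)"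
      unfolding g_def by measurable
    show ?thesis unfolding G_def by measurable
  qed
  have G_le: "G \<omega> \<le> 1" for \<omega>
  proof -
    have "G \<omega> \<le> (\<integral>\<^sup>+\<theta>. indicator {0<..<1::real} \<theta> \<partial>lborel)"
      unfolding G_def g_def by (intro nn_integral_mono) (auto simp: indicator_def)
    then show ?thesis by simp
  qed
  have occ: "AE \<omega> in B t x y. occupation \<Omega> Y t \<omega> ^ k = enn2real (ennreal (t ^ k) * G \<omega> ^ k)"
  proof -
    obtain N where N: "N \<in> null_sets lborel" "A - \<Omega> \<subseteq> N"
      using null unfolding null_sets_completion_iff2 by auto
    from bridge_avoids_null_set[OF t N(1), of x y] AE_space show ?thesis
    proof eventually_elim
      case (elim \<omega>)
      have Zs[measurable]: "(\<lambda>s. Z (s, \<omega>)) \<in> borel_measurable borel"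
        by (rule measurable_compose[OF measurable_Pair2'[OF elim(2)] Z])
      let ?S = "{s\<in>{0..t}. Y s \<omega> \<in> A}"
      have "AE s in lborel. s \<in> {0..t} \<longrightarrow> Y s \<omega> \<notin> A - \<Omega>"
        using elim(1) by eventually_elim (use N(2) in auto)
      then have occ: "occupation \<Omega> Y t \<omega> = measure lborel ?S"
        using occupation_cong[OF A, of t Y \<omega>] Zs by (simp add: Z_def)
      have "?S = {s. s \<in> {0..t} \<and> Z (s, \<omega>) \<in> A}" by (auto simp: Z_def)
      then have S[measurable]: "?S \<in> sets borel" by simp
      have "emeasure lborel ?S = (\<integral>\<^sup>+s. indicator ?S s \<partial>lborel)"
        by (rule nn_integral_indicator[symmetric]) (use S in simp)
      also have "\<dots> = ennreal t * (\<integral>\<^sup>+\<theta>. indicator ?S (0 + t * \<theta>) \<partial>lborel)"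
        using nn_integral_real_affine[of "indicator ?S" t 0] S t by (simp del: mem_Collect_eq)
      also have "(\<integral>\<^sup>+\<theta>. indicator ?S (0 + t * \<theta>) \<partial>lborel) = G \<omega>"
        unfolding G_def
      proof (intro nn_integral_cong_AE)
        have "AE \<theta> in lborel. \<theta> \<noteq> 0 \<and> \<theta> \<noteq> (1::real)" by (simp add: AE_lborel_singleton)
        then show "AE \<theta> in lborel. indicator ?S (0 + t * \<theta>) = g \<omega> \<theta>"
        proof eventually_elim
          case (elim \<theta>)
          have "0 \<le> t * \<theta> \<longleftrightarrow> 0 \<le> \<theta>" "t * \<theta> \<le> t \<longleftrightarrow> \<theta> \<le> 1"
            using t by (auto simp: zero_le_mult_iff mult_le_cancel_left1)
          with elim show ?case by (auto simp: g_def Z_def indicator_def)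
        qed
      qed
      finally have "measure lborel ?S = enn2real (ennreal t * G \<omega>)" by (simp add: measure_def)
      moreover have "(enn2real (ennreal t * G \<omega>)) ^ k = enn2real ((ennreal t * G \<omega>) ^ k)"
        by (induction k) (auto simp: enn2real_mult)
      ultimately show ?case using t by (simp add: occ power_mult_distrib ennreal_power)
    qed
  qed
  have g_prod: "(\<Prod>i<k. g \<omega> (l i)) = (if \<forall>i<k. 0 < l i \<and> l i < 1 \<and> Y (t * l i) \<omega> \<in> A then 1 else 0)" for \<omega> l
  proof -
    have "g \<omega> (l i) = (if 0 < l i \<and> l i < 1 \<and> Y (t * l i) \<omega> \<in> A then 1 else 0)" for i
      using t by (auto simp: g_def Z_def indicator_def mult_le_cancel_left1)
    then show ?thesis by (auto simp: prod_zero_iff intro!: prod.neutral)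
  qed
  have inner: "G \<omega> ^ k = fact k * (\<integral>\<^sup>+l. indicator (simplex_I k) l *
      indicator {\<omega>\<in>space (B t x y). \<forall>s\<in>set (map (\<lambda>i. t * l i) [0..<k]). Y s \<omega> \<in> A} \<omega> \<partial>?M)"
    if \<omega>: "\<omega> \<in> space (B t x y)" for \<omega>
  proof -
    have "G \<omega> ^ k = (\<integral>\<^sup>+l. (\<Prod>i<k. g \<omega> (l i)) \<partial>?M)"
      unfolding G_def using g_meas1[OF \<omega>] by (subst lborel_PiM.product_nn_integral_prod) auto
    also have "\<dots> = fact k * (\<integral>\<^sup>+l. indicator {l. \<forall>i. Suc i < k \<longrightarrow> l i < l (Suc i)} l * (\<Prod>i<k. g \<omega> (l i)) \<partial>?M)"
      using g_meas1[OF \<omega>] by (rule nn_integral_PiM_prod_eq_fact_increasing)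
    also have "(\<integral>\<^sup>+l. indicator {l. \<forall>i. Suc i < k \<longrightarrow> l i < l (Suc i)} l * (\<Prod>i<k. g \<omega> (l i)) \<partial>?M)
      = (\<integral>\<^sup>+l. indicator (simplex_I k) l *
      indicator {\<omega>\<in>space (B t x y). \<forall>s\<in>set (map (\<lambda>i. t * l i) [0..<k]). Y s \<omega> \<in> A} \<omega> \<partial>?M)"
    proof (intro nn_integral_cong)
      fix l assume "l \<in> space ?M"
      then have l: "l \<in> simplex_I k \<longleftrightarrow> (\<forall>i<k. 0 < l i \<and> l i < 1) \<and> (\<forall>i. Suc i < k \<longrightarrow> l i < l (Suc i))"
        by (simp add: simplex_I_def space_PiM)
      show "indicator {l. \<forall>i. Suc i < k \<longrightarrow> l i < l (Suc i)} l * (\<Prod>i<k. g \<omega> (l i))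
        = indicator (simplex_I k) l *
      (indicator {\<omega>\<in>space (B t x y). \<forall>s\<in>set (map (\<lambda>i. t * l i) [0..<k]). Y s \<omega> \<in> A} \<omega> :: ennreal)"
        unfolding g_prod using l \<omega> by (auto simp: indicator_def)
    qed
    finally show ?thesis .
  qed
  define H :: "(nat \<Rightarrow> real) \<Rightarrow> 'v \<Rightarrow> ennreal"
    where "H l \<omega> = indicator (simplex_I k) l *
      indicator {\<omega>\<in>space (B t x y). \<forall>s\<in>set (map (\<lambda>i. t * l i) [0..<k]). Y s \<omega> \<in> A} \<omega>" for l \<omega>
  have H_meas: "(\<lambda>x. H (fst x) (snd x)) \<in> borel_measurable (?M \<Otimes>\<^sub>M B t x y)"
  proof -
    \<comment> \<open>Joint measurability of \<open>H\<close> is inherited from the product of the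
      \<open>g\<close>, with which it agrees on the product space; the event defining
      \<open>H\<close> depends on \<open>l\<close> through the sampled times.\<close>
    have "(\<lambda>x. indicator (simplex_I k) (fst x) * (\<Prod>i<k. g (snd x) (fst x i))) \<in> borel_measurable (?M \<Otimes>\<^sub>M B t x y)"
      using g_meas2 by (intro borel_measurable_times_ennreal borel_measurable_prod_ennreal) auto
    moreover have "H (fst v) (snd v) = indicator (simplex_I k) (fst v) * (\<Prod>i<k. g (snd v) (fst v i))"
      if "v \<in> space (?M \<Otimes>\<^sub>M B t x y)" for v
      unfolding g_prod using that
      by (auto simp: H_def indicator_def simplex_I_def space_pair_measure space_PiM)
    ultimately show ?thesis by (simp cong: measurable_cong)
  qed
  have H_meas1: "(\<lambda>\<omega>. \<integral>\<^sup>+l. H l \<omega> \<partial>?M) \<in> borel_measurable (B t x y)"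
    using M.borel_measurable_nn_integral_fst[OF measurable_pair_swap[OF H_meas]] by simp
  have H_meas2: "(\<lambda>l. \<integral>\<^sup>+\<omega>. H l \<omega> \<partial>B t x y) \<in> borel_measurable ?M"
    using sigma_finite_measure.borel_measurable_nn_integral_fst[OF prob_space_imp_sigma_finite[OF prob_space_axioms] H_meas] by simp
  have H_int: "(\<integral>\<^sup>+\<omega>. H l \<omega> \<partial>B t x y) = indicator (simplex_I k) l *
      emeasure (B t x y) {\<omega>\<in>space (B t x y). \<forall>s\<in>set (map (\<lambda>i. t * l i) [0..<k]). Y s \<omega> \<in> A}" for l
  proof -
    note [measurable] = measurable_Y[OF t]
    have "{\<omega>\<in>space (B t x y). \<forall>s\<in>set (map (\<lambda>i. t * l i) [0..<k]). Y s \<omega> \<in> A} \<in> sets (B t x y)"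
      by measurable
    then show ?thesis by (simp add: H_def nn_integral_cmult_indicator)
  qed
  have "(\<integral>\<omega>. (occupation \<Omega> Y t \<omega>) ^ k \<partial>completion (B t x y))
      = (\<integral>\<omega>. enn2real (ennreal (t ^ k) * G \<omega> ^ k) \<partial>B t x y)"
    by (intro integral_completion_AE_eq occ) measurable
  also have "\<dots> = enn2real (\<integral>\<^sup>+\<omega>. ennreal (enn2real (ennreal (t ^ k) * G \<omega> ^ k)) \<partial>B t x y)"
    by (intro integral_eq_nn_integral) auto
  also have "(\<integral>\<^sup>+\<omega>. ennreal (enn2real (ennreal (t ^ k) * G \<omega> ^ k)) \<partial>B t x y)
      = (\<integral>\<^sup>+\<omega>. ennreal (t ^ k) * G \<omega> ^ k \<partial>B t x y)"
  proof (intro nn_integral_cong ennreal_enn2real)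
    fix \<omega>
    have "G \<omega> ^ k \<le> 1" using G_le[of \<omega>] by (rule power_le_one[rotated]) simp
    then show "ennreal (t ^ k) * G \<omega> ^ k < \<top>"
      by (auto simp: ennreal_mult_less_top intro: le_less_trans)
  qed
  also have "\<dots> = ennreal (t ^ k) * (\<integral>\<^sup>+\<omega>. G \<omega> ^ k \<partial>B t x y)"
    by (intro nn_integral_cmult) measurable
  also have "(\<integral>\<^sup>+\<omega>. G \<omega> ^ k \<partial>B t x y) = (\<integral>\<^sup>+\<omega>. fact k * (\<integral>\<^sup>+l. H l \<omega> \<partial>?M) \<partial>B t x y)"
    by (intro nn_integral_cong) (simp add: inner H_def)
  also have "\<dots> = fact k * (\<integral>\<^sup>+\<omega>. (\<integral>\<^sup>+l. H l \<omega> \<partial>?M) \<partial>B t x y)"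
    using H_meas1 by (rule nn_integral_cmult)
  also have "(\<integral>\<^sup>+\<omega>. (\<integral>\<^sup>+l. H l \<omega> \<partial>?M) \<partial>B t x y) = (\<integral>\<^sup>+l. (\<integral>\<^sup>+\<omega>. H l \<omega> \<partial>B t x y) \<partial>?M)"
    using H_meas by (intro Fubini') (simp add: case_prod_beta)
  finally have moment: "(\<integral>\<omega>. (occupation \<Omega> Y t \<omega>) ^ k \<partial>completion (B t x y))
    = enn2real (ennreal (t ^ k) * (fact k * (\<integral>\<^sup>+l. (\<integral>\<^sup>+\<omega>. H l \<omega> \<partial>B t x y) \<partial>?M)))" .
  have "ennreal (ptd \<alpha> t x y) * (\<integral>\<^sup>+l. (\<integral>\<^sup>+\<omega>. H l \<omega> \<partial>B t x y) \<partial>?M)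
     = (\<integral>\<^sup>+l. ennreal (ptd \<alpha> t x y) * (\<integral>\<^sup>+\<omega>. H l \<omega> \<partial>B t x y) \<partial>?M)"
    using H_meas2 by (rule nn_integral_cmult[symmetric])
  also have "\<dots> = (\<integral>\<^sup>+l. indicator (simplex_I k) l *
        nchain \<alpha> A (\<lambda>r z. ennreal (ptd \<alpha> (t - r) z y)) 0 x (map (\<lambda>i. t * l i) [0..<k]) \<partial>?M)"
  proof (intro nn_integral_cong)
    fix l
    show "ennreal (ptd \<alpha> t x y) * (\<integral>\<^sup>+\<omega>. H l \<omega> \<partial>B t x y) = indicator (simplex_I k) l *
        nchain \<alpha> A (\<lambda>r z. ennreal (ptd \<alpha> (t - r) z y)) 0 x (map (\<lambda>i. t * l i) [0..<k])"
    proof (cases "l \<in> simplex_I k")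
      case True
      then show ?thesis
        using emeasure_Y_chain[OF A(1) simplex_I_sorted[OF True t] t, of x y] by (simp add: H_int)
    qed (simp add: H_int)
  qed
  finally have eq: "ennreal (ptd \<alpha> t x y) * (\<integral>\<^sup>+l. (\<integral>\<^sup>+\<omega>. H l \<omega> \<partial>B t x y) \<partial>?M)
     = (\<integral>\<^sup>+l. indicator (simplex_I k) l *
        nchain \<alpha> A (\<lambda>r z. ennreal (ptd \<alpha> (t - r) z y)) 0 x (map (\<lambda>i. t * l i) [0..<k]) \<partial>?M)" .
  \<comment> \<open>\<open>enn2real\<close> is multiplicative even at infinity, which it maps to
    0.\<close>
  have "p * enn2real (T * (F * I)) = enn2real (F * T * (ennreal p * I))" if "0 \<le> p" for p T F I
    using that by (simp add: enn2real_mult mult_ac)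
  from this[OF ptd_nonneg[OF t]] show ?thesis
    unfolding moment eq[symmetric] .
qed

end

section \<open>Integration over the end points and short times\<close>

context stable_process_with_bridges
begin

text \<open>\<open>h_chain\<close> is driven by gaps and \<open>nchain\<close> by absolute times, so
  the latter starts at \<open>t * l m\<close>. The induction leaves \<open>m\<close> free because
  the tail of the chain starts at index \<open>Suc m\<close>. Replacing \<Omega> by \<open>A\<close>
  affects each integral only on a null set.\<close>

lemma h_chain_eq_nchain:
  assumes t: "0 < t" and A [measurable]: "A \<in> sets borel" and ae: "AE w in lborel. w \<in> \<Omega> \<longleftrightarrow> w \<in> A"
    and "\<forall>i\<in>{m..<m + n}. l i < l (Suc i)" "0 \<le> l m"
  shows "h_chain \<alpha> \<Omega> t (z::'a) (map (\<lambda>i. l (Suc i) - l i) [m..<m + n])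
    = enn2real (nchain \<alpha> A (\<lambda>_ _. 1) (t * l m) z (map (\<lambda>i. t * l i) [Suc m..<Suc (m + n)]))"
  using assms(4,5)
proof (induction n arbitrary: m z)
  case 0
  then show ?case by simp
next
  case (Suc n)
  let ?ss = "map (\<lambda>i. t * l i) [Suc (Suc m)..<Suc (Suc m + n)]"
  let ?F = "\<lambda>w. indicator A w * ennreal (ptd \<alpha> (t * l (Suc m) - t * l m) z w)
      * nchain \<alpha> A (\<lambda>_ _. 1) (t * l (Suc m)) w ?ss"
  have "l m < l (Suc m)" using Suc.prems(1) by force
  with Suc.prems(2) have lm: "l m < l (Suc m)" "0 \<le> l (Suc m)" by simp_all
  have IH: "h_chain \<alpha> \<Omega> t w (map (\<lambda>i. l (Suc i) - l i) [Suc m..<Suc m + n])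
      = enn2real (nchain \<alpha> A (\<lambda>_ _. 1) (t * l (Suc m)) w ?ss)" for w
    using Suc.prems lm by (intro Suc.IH) auto
  have p: "0 < t * l (Suc m) - t * l m" using lm t by simp
  have srt: "sorted_wrt (<) (t * l (Suc m) # ?ss)"
  proof -
    have "sorted_wrt (<) (map (\<lambda>i. t * l i) [Suc m..<Suc (Suc m + n)])"
      using Suc.prems t
      by (subst sorted_wrt_iff_nth_Suc_transp) (auto simp: transp_on_def simp del: upt_Suc)
    moreover have "[Suc m..<Suc (Suc m + n)] = Suc m # [Suc (Suc m)..<Suc (Suc m + n)]"
      by (rule upt_conv_Cons) simp
    ultimately show ?thesis by (simp del: upt_Suc)
  qed
  have le1: "nchain \<alpha> A (\<lambda>_ _. 1) (t * l (Suc m)) w ?ss \<le> 1" for w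
    using t lm by (intro nchain_one_le_1[OF A _ srt]) simp
  have [measurable]: "(\<lambda>w. nchain \<alpha> A (\<lambda>_ _. 1) (t * l (Suc m)) w ?ss) \<in> borel_measurable borel"
    by (rule measurable_nchain_fixed[OF A]) simp
  have "h_chain \<alpha> \<Omega> t z (map (\<lambda>i. l (Suc i) - l i) [m..<m + Suc n])
     = (\<integral>w. indicator \<Omega> w * ptd \<alpha> (t * l (Suc m) - t * l m) z w
         * enn2real (nchain \<alpha> A (\<lambda>_ _. 1) (t * l (Suc m)) w ?ss) \<partial>lebesgue)"
    using upt_conv_Cons[of m "m + Suc n"] IH by (simp add: right_diff_distrib)
  also have "\<dots> = enn2real (\<integral>\<^sup>+w. ?F w \<partial>lborel)"
  proof (rule integral_lebesgue_enn2real)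
    show "AE w in lborel. indicator \<Omega> w * ptd \<alpha> (t * l (Suc m) - t * l m) z w
         * enn2real (nchain \<alpha> A (\<lambda>_ _. 1) (t * l (Suc m)) w ?ss) = enn2real (?F w)"
      using ae by eventually_elim (use p in \<open>simp add: enn2real_mult ptd_nonneg indicator_def\<close>)
    have "?F w < \<infinity>" for w
      using le_less_trans[OF le1[of w], of \<top>]
      by (auto simp: ennreal_mult_less_top indicator_def)
    then show "AE w in lborel. ?F w < \<infinity>" by simp
  qed measurable
  also have "\<dots> = enn2real (nchain \<alpha> A (\<lambda>_ _. 1) (t * l m) z (map (\<lambda>i. t * l i) [Suc m..<Suc (m + Suc n)]))"
    using upt_conv_Cons[of "Suc m" "Suc (m + Suc n)"] by simp
  finally show ?case .
qed

section \<open>Integration over the starting point and the bounds for \<open>Tk\<close>\<close>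

text \<open>For increasing \<open>l\<close> this is the probability of finding the process in
  \<open>A\<close> at all times \<open>t * l i\<close>, integrated over every starting point in the
  space. It turns out to be the \<open>ennreal\<close> form of \<open>hk\<close>.\<close>

definition visit_integral :: "'a set \<Rightarrow> nat \<Rightarrow> real \<Rightarrow> (nat \<Rightarrow> real) \<Rightarrow> ennreal" where
  "visit_integral A k t l = (\<integral>\<^sup>+x. nchain \<alpha> A (\<lambda>_ _. 1) 0 x (map (\<lambda>i. t * l i) [0..<k]) \<partial>lborel)"

text \<open>Invariance of Lebesgue measure removes the starting point, so that the integration
  begins at the first visit. There is a first visit because the number of times is
  \<open>Suc n\<close>.\<close>

lemma visit_integral_eq:
  assumes "A \<in> sets borel" "0 < t" "l \<in> simplex_I (Suc n)"
  shows "visit_integral A (Suc n) t l = (\<integral>\<^sup>+z. indicator A z *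
     nchain \<alpha> A (\<lambda>_ _. 1) (t * l 0) z (map (\<lambda>i. t * l i) [1..<Suc n]) \<partial>lborel)"
proof -
  have "0 < t * l 0" using assms by (simp add: simplex_I_def)
  then show ?thesis
    unfolding visit_integral_def using nn_integral_nchain_initial[OF assms(1), of 0 "t * l 0"]
    by (simp add: upt_conv_Cons del: nchain.simps upt_Suc)
qed

text \<open>Given the first visit in \<open>A\<close>, the rest of the chain is at most 1.\<close>

lemma visit_integral_le:
  assumes "A \<in> sets borel" "0 < t" "l \<in> simplex_I (Suc n)"
  shows "visit_integral A (Suc n) t l \<le> emeasure lborel A"
proof -
  have "sorted_wrt (<) (t * l 0 # map (\<lambda>i. t * l i) [1..<Suc n])" "0 \<le> t * l 0"
    using simplex_I_sorted(1)[OF assms(3,2)] by (simp_all add: upt_conv_Cons del: upt_Suc)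
  then have "visit_integral A (Suc n) t l \<le> (\<integral>\<^sup>+z. indicator A z * 1 \<partial>lborel)"
    unfolding visit_integral_eq[OF assms]
    by (intro nn_integral_mono mult_left_mono nchain_one_le_1 assms) auto
  then show ?thesis using assms by simp
qed

lemma measurable_visit_integral:
  assumes A: "A \<in> sets borel"
  shows "visit_integral A k t \<in> borel_measurable (PiM {..<k} (\<lambda>_. lborel))"
proof -
  let ?M = "PiM {..<k} (\<lambda>_. lborel :: real measure)"
  have s: "(\<lambda>n. t * fst n i) \<in> borel_measurable (?M \<Otimes>\<^sub>M borel)" if "i < k" for i
    using that measurable_compose[OF measurable_fst measurable_component_singleton[of i "{..<k}"]]
    by (intro borel_measurable_times) simp_all
  have "(\<lambda>n. nchain \<alpha> A (\<lambda>_ _. 1) 0 (snd n) (map (\<lambda>i. t * fst n i) [0..<k]))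
      \<in> borel_measurable (?M \<Otimes>\<^sub>M borel)"
    by (rule measurable_nchain[OF A]) (use s in auto)
  then have "(\<lambda>n. nchain \<alpha> A (\<lambda>_ _. 1) 0 (snd n) (map (\<lambda>i. t * fst n i) [0..<k]))
      \<in> borel_measurable (?M \<Otimes>\<^sub>M lborel)"
    by simp
  from lborel.borel_measurable_nn_integral_fst[OF this] show ?thesis
    unfolding visit_integral_def[abs_def] by simp
qed

lemma hk_eq_visit_integral:
  assumes t: "0 < t" and A [measurable]: "A \<in> sets borel" and ae: "AE w in lborel. w \<in> \<Omega> \<longleftrightarrow> w \<in> A"
    and l: "l \<in> simplex_I (Suc n)"
  shows "hk \<alpha> \<Omega> t (map (\<lambda>i. l (Suc i) - l i) [0..<n]) = enn2real (visit_integral A (Suc n) t l)"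
proof -
  let ?c = "\<lambda>z. nchain \<alpha> A (\<lambda>_ _. 1) (t * l 0) z (map (\<lambda>i. t * l i) [1..<Suc n])"
  have srt: "sorted_wrt (<) (t * l 0 # map (\<lambda>i. t * l i) [1..<Suc n])" "0 \<le> t * l 0"
    using simplex_I_sorted(1)[OF l t] by (simp_all add: upt_conv_Cons del: upt_Suc)
  have h: "h_chain \<alpha> \<Omega> t z (map (\<lambda>i. l (Suc i) - l i) [0..<n]) = enn2real (?c z)" for z
    using h_chain_eq_nchain[OF t A ae, of 0 n l z] l by (auto simp: simplex_I_def simp del: upt_Suc)
  have [measurable]: "?c \<in> borel_measurable borel"
    by (rule measurable_nchain_fixed[OF A]) simp
  have "hk \<alpha> \<Omega> t (map (\<lambda>i. l (Suc i) - l i) [0..<n]) = enn2real (\<integral>\<^sup>+z. indicator A z * ?c z \<partial>lborel)"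
    unfolding hk_def h
  proof (rule integral_lebesgue_enn2real)
    show "AE z in lborel. indicator \<Omega> z * enn2real (?c z) = enn2real (indicator A z * ?c z)"
      using ae by eventually_elim (simp add: indicator_def)
    have "indicator A z * ?c z < \<infinity>" for z
      using le_less_trans[OF nchain_one_le_1(1)[OF A srt(2,1)], of \<top> z]
      by (auto simp: ennreal_mult_less_top indicator_def)
    then show "AE z in lborel. indicator A z * ?c z < \<infinity>" by simp
  qed measurable
  then show ?thesis using visit_integral_eq[OF A t l] by simp
qed

text \<open>In the moment formula for the bridge, Tonelli's theorem moves the integrals over
  \<open>y\<close> and then \<open>x\<close> inside the one over the simplex. The first replaces the
  bridge chain by that of the process, the second yields \<open>visit_integral\<close>.\<close>

lemma Tk_eq_simplex_integral:
  assumes t: "0 < t" and A [measurable]: "A \<in> sets borel" "\<Omega> \<subseteq> A" and null: "A - \<Omega> \<in> null_sets lebesgue"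
  shows "Tk \<alpha> B Y \<Omega> k t = enn2real (fact k * ennreal (t ^ k) *
     (\<integral>\<^sup>+l. indicator (simplex_I k) l * visit_integral A k t l \<partial>PiM {..<k} (\<lambda>_. lborel)))"
proof -
  let ?M = "PiM {..<k} (\<lambda>_. lborel :: real measure)"
  interpret M: sigma_finite_measure ?M by (rule lborel_PiM.sigma_finite) simp
  interpret Mb: pair_sigma_finite ?M "lborel :: 'a measure" by standard
  define C where "C = (fact k * ennreal (t ^ k) :: ennreal)"
  define D where "D x y l = nchain \<alpha> A (\<lambda>r z. ennreal (ptd \<alpha> (t - r) z y)) 0 x (map (\<lambda>i. t * l i) [0..<k])"
    for x y l
  define E where "E x l = nchain \<alpha> A (\<lambda>_ _. 1) 0 x (map (\<lambda>i. t * l i) [0..<k])" for x l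
  define F where "F x y = C * (\<integral>\<^sup>+l. indicator (simplex_I k) l * D x y l \<partial>?M)" for x y
  define F' where "F' x = C * (\<integral>\<^sup>+l. indicator (simplex_I k) l * E x l \<partial>?M)" for x
  have C: "C < \<infinity>" unfolding C_def
    by (simp add: ennreal_mult_less_top flip: ennreal_fact)
  have D_meas: "(\<lambda>v. D (fst (fst v)) (snd (fst v)) (snd v)) \<in> borel_measurable ((borel \<Otimes>\<^sub>M borel) \<Otimes>\<^sub>M ?M)"
  proof -
    let ?N = "((borel :: 'a measure) \<Otimes>\<^sub>M (borel :: 'a measure)) \<Otimes>\<^sub>M ?M"
    have s: "(\<lambda>v. t * snd v i) \<in> borel_measurable ?N" if "i < k" for i
      using that measurable_compose[OF measurable_snd measurable_component_singleton[of i "{..<k}"]]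
      by (intro borel_measurable_times) simp_all
    have g: "(\<lambda>(v, r, z). ennreal (ptd \<alpha> (t - r) z (snd (fst v)))) \<in> borel_measurable (?N \<Otimes>\<^sub>M borel \<Otimes>\<^sub>M borel)"
      unfolding case_prod_beta by measurable
    show ?thesis unfolding D_def
      by (rule measurable_nchain[OF A(1) g]) (use s in auto)
  qed
  have E_meas: "(\<lambda>v. E (fst v) (snd v)) \<in> borel_measurable (borel \<Otimes>\<^sub>M ?M)"
  proof -
    let ?N = "(borel :: 'a measure) \<Otimes>\<^sub>M ?M"
    have s: "(\<lambda>v. t * snd v i) \<in> borel_measurable ?N" if "i < k" for i
      using that measurable_compose[OF measurable_snd measurable_component_singleton[of i "{..<k}"]]
      by (intro borel_measurable_times) simp_all
    show ?thesis unfolding E_def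
      by (rule measurable_nchain[OF A(1)]) (use s in auto)
  qed
  have D_meas1: "(\<lambda>v. D x (fst v) (snd v)) \<in> borel_measurable (borel \<Otimes>\<^sub>M ?M)" for x
  proof -
    have "(\<lambda>v. ((x, fst v), snd v)) \<in> (borel \<Otimes>\<^sub>M ?M) \<rightarrow>\<^sub>M ((borel \<Otimes>\<^sub>M borel) \<Otimes>\<^sub>M ?M)"
      by measurable
    from measurable_compose[OF this D_meas] show ?thesis by simp
  qed
  have indD: "(\<lambda>v. indicator (simplex_I k) (snd v) * D x (fst v) (snd v)) \<in> borel_measurable (borel \<Otimes>\<^sub>M ?M)" for x
    by (intro borel_measurable_times_ennreal D_meas1 measurable_compose[OF measurable_snd borel_measurable_indicator])
       (rule measurable_simplex_I)
  have indE: "(\<lambda>v. indicator (simplex_I k) (snd v) * E (fst v) (snd v)) \<in> borel_measurable (borel \<Otimes>\<^sub>M ?M)"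
    by (intro borel_measurable_times_ennreal E_meas measurable_compose[OF measurable_snd borel_measurable_indicator])
       (rule measurable_simplex_I)
  have F_meas: "F x \<in> borel_measurable borel" for x
    unfolding F_def[abs_def] using M.borel_measurable_nn_integral_fst[OF indD]
    by (intro borel_measurable_times_ennreal) simp_all
  have intE: "(\<lambda>x. \<integral>\<^sup>+l. indicator (simplex_I k) l * E x l \<partial>?M) \<in> borel_measurable borel"
    using M.borel_measurable_nn_integral_fst[OF indE] by simp
  have F'_meas: "F' \<in> borel_measurable borel"
    unfolding F'_def[abs_def] using intE by (intro borel_measurable_times_ennreal) simp_all
  have F_int: "(\<integral>\<^sup>+y. F x y \<partial>lborel) = F' x" for x
  proof -
    have "(\<integral>\<^sup>+y. F x y \<partial>lborel) = C * (\<integral>\<^sup>+y. (\<integral>\<^sup>+l. indicator (simplex_I k) l * D x y l \<partial>?M) \<partial>lborel)"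
      unfolding F_def using M.borel_measurable_nn_integral_fst[OF indD] by (intro nn_integral_cmult) simp
    also have "(\<integral>\<^sup>+y. (\<integral>\<^sup>+l. indicator (simplex_I k) l * D x y l \<partial>?M) \<partial>lborel)
        = (\<integral>\<^sup>+l. (\<integral>\<^sup>+y. indicator (simplex_I k) l * D x y l \<partial>lborel) \<partial>?M)"
      using measurable_pair_swap[OF indD] by (intro Mb.Fubini') (simp add: case_prod_beta)
    also have "\<dots> = (\<integral>\<^sup>+l. indicator (simplex_I k) l * E x l \<partial>?M)"
    proof (intro nn_integral_cong)
      fix l :: "nat \<Rightarrow> real"
      show "(\<integral>\<^sup>+y. indicator (simplex_I k) l * D x y l \<partial>lborel) = indicator (simplex_I k) l * E x l"
      proof (cases "l \<in> simplex_I k")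
        case True
        have "(\<integral>\<^sup>+y. D x y l \<partial>lborel) = E x l"
          unfolding D_def E_def using simplex_I_sorted[OF True t] t
          by (intro nn_integral_nchain_terminal A(1)) auto
        then show ?thesis using True by simp
      qed simp
    qed
    finally show ?thesis by (simp add: F'_def)
  qed
  \<comment> \<open>The chain is at most 1 and the simplex has finite volume. By
    \<open>F_int\<close> this also makes \<open>F x y\<close> finite for almost every
    \<open>y\<close>, as the return to Bochner integrals requires.\<close>
  have F'_fin: "F' x < \<infinity>" for x
  proof -
    have "(\<integral>\<^sup>+l. indicator (simplex_I k) l * E x l \<partial>?M) \<le> (\<integral>\<^sup>+l. indicator (simplex_I k) l \<partial>?M)"
    proof (intro nn_integral_mono)
      fix l :: "nat \<Rightarrow> real"
      show "indicator (simplex_I k) l * E x l \<le> indicator (simplex_I k) l"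
        using nchain_one_le_1(1)[OF A(1) _ simplex_I_sorted(1)[OF _ t], of l k x]
        by (auto simp: E_def indicator_def)
    qed
    also have "\<dots> = emeasure ?M (simplex_I k)" by (rule nn_integral_indicator) (rule measurable_simplex_I)
    also have "\<dots> < \<infinity>"
      using emeasure_simplex_I[of k] by (cases "emeasure ?M (simplex_I k) = \<top>") (auto simp: less_top ennreal_mult_top)
    finally show ?thesis using C by (simp add: F'_def ennreal_mult_less_top)
  qed
  have inner: "(\<integral>y. ptd \<alpha> t x y * (\<integral>\<omega>. (occupation \<Omega> Y t \<omega>) ^ k \<partial>completion (B t x y)) \<partial>lebesgue)
      = enn2real (F' x)" for x
    unfolding F_int[symmetric]
  proof (rule integral_lebesgue_enn2real[OF F_meas])
    show "AE y in lborel. ptd \<alpha> t x y * (\<integral>\<omega>. (occupation \<Omega> Y t \<omega>) ^ k \<partial>completion (B t x y)) = enn2real (F x y)"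
      unfolding F_def C_def D_def by (intro AE_I2 bridge_occupation_moment t A null)
    have "(\<integral>\<^sup>+y. F x y \<partial>lborel) \<noteq> \<infinity>" using F_int[of x] F'_fin[of x] by simp
    then have "AE y in lborel. F x y \<noteq> \<infinity>" using F_meas by (intro nn_integral_PInf_AE) simp_all
    then show "AE y in lborel. F x y < \<infinity>" by (simp add: less_top)
  qed
  have "Tk \<alpha> B Y \<Omega> k t = (\<integral>x. enn2real (F' x) \<partial>lebesgue)"
    unfolding Tk_def inner ..
  also have "\<dots> = enn2real (\<integral>\<^sup>+x. F' x \<partial>lborel)"
    using F'_fin by (intro integral_lebesgue_enn2real F'_meas) simp_all
  also have "(\<integral>\<^sup>+x. F' x \<partial>lborel) = C * (\<integral>\<^sup>+x. (\<integral>\<^sup>+l. indicator (simplex_I k) l * E x l \<partial>?M) \<partial>lborel)"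
    unfolding F'_def using intE by (intro nn_integral_cmult) simp
  also have "(\<integral>\<^sup>+x. (\<integral>\<^sup>+l. indicator (simplex_I k) l * E x l \<partial>?M) \<partial>lborel)
      = (\<integral>\<^sup>+l. (\<integral>\<^sup>+x. indicator (simplex_I k) l * E x l \<partial>lborel) \<partial>?M)"
    using measurable_pair_swap[OF indE] by (intro Mb.Fubini') (simp add: case_prod_beta)
  also have "\<dots> = (\<integral>\<^sup>+l. indicator (simplex_I k) l * visit_integral A k t l \<partial>?M)"
  proof (intro nn_integral_cong)
    fix l :: "nat \<Rightarrow> real"
    show "(\<integral>\<^sup>+x. indicator (simplex_I k) l * E x l \<partial>lborel) = indicator (simplex_I k) l * visit_integral A k t l"
      by (cases "l \<in> simplex_I k") (simp_all add: E_def visit_integral_def)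
  qed
  finally show ?thesis by (simp add: C_def)
qed

text \<open>As \<open>visit_integral\<close> is bounded by the finite measure of \<open>A\<close>,
  \<open>enn2real\<close> can be taken inside the integral, where it produces \<open>hk\<close>
  pointwise on the simplex.\<close>

lemma simplex_integral_eq_hk:
  assumes t: "0 < t" and A: "A \<in> sets borel" "emeasure lborel A < \<infinity>"
    and ae: "AE w in lborel. w \<in> \<Omega> \<longleftrightarrow> w \<in> A"
  shows "enn2real (\<integral>\<^sup>+l. indicator (simplex_I (Suc n)) l * visit_integral A (Suc n) t l \<partial>PiM {..<Suc n} (\<lambda>_. lborel))
    = (\<integral>l. indicator (simplex_I (Suc n)) l * hk \<alpha> \<Omega> t (map (\<lambda>i. l (Suc i) - l i) [0..<n]) \<partial>PiM {..<Suc n} (\<lambda>_. lborel))"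
proof -
  let ?M = "PiM {..<Suc n} (\<lambda>_. lborel :: real measure)"
  let ?J = "\<lambda>l. indicator (simplex_I (Suc n)) l * visit_integral A (Suc n) t l"
  note [measurable] = measurable_visit_integral[OF A(1), of "Suc n" t] measurable_simplex_I[of "Suc n"]
  have eq: "indicator (simplex_I (Suc n)) l * hk \<alpha> \<Omega> t (map (\<lambda>i. l (Suc i) - l i) [0..<n]) = enn2real (?J l)" for l
    by (cases "l \<in> simplex_I (Suc n)") (simp_all add: hk_eq_visit_integral[OF t A(1) ae])
  have fin: "?J l < \<top>" for l
    using le_less_trans[OF visit_integral_le[OF A(1) t, of l n] A(2)] by (simp add: indicator_def)
  have "(\<integral>l. enn2real (?J l) \<partial>?M) = enn2real (\<integral>\<^sup>+l. ennreal (enn2real (?J l)) \<partial>?M)"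
    by (intro integral_eq_nn_integral) auto
  then show ?thesis unfolding eq using fin by simp
qed

text \<open>A path that stays in \<Omega> is in \<open>A\<close> at each of the finitely many times
  \<open>t * l i\<close>. The latter event is measurable, so its outer probability is its
  probability.\<close>

lemma spectral_heat_content_le_visit_integral:
  assumes t: "0 < t" and A: "A \<in> sets borel" "\<Omega> \<subseteq> A" and l: "l \<in> simplex_I k"
  shows "(\<integral>\<^sup>+x. indicator \<Omega> x *
        outer_measure_of (P x) {\<omega>\<in>space (P x). \<forall>s\<in>{0..t}. X s \<omega> \<in> \<Omega>} \<partial>lebesgue)
    \<le> visit_integral A k t l"
proof -
  let ?ss = "map (\<lambda>i. t * l i) [0..<k]"
  have "outer_measure_of (P x) {\<omega>\<in>space (P x). \<forall>s\<in>{0..t}. X s \<omega> \<in> \<Omega>} \<le> nchain \<alpha> A (\<lambda>_ _. 1) 0 x ?ss" for x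
  proof -
    let ?E = "{\<omega>\<in>space (P x). \<forall>s\<in>set ?ss. X s \<omega> \<in> A}"
    note [measurable] = measurable_X A(1)
    have "set ?ss \<subseteq> {0..t}" using l t by (auto simp: simplex_I_def less_imp_le)
    then have "outer_measure_of (P x) {\<omega>\<in>space (P x). \<forall>s\<in>{0..t}. X s \<omega> \<in> \<Omega>} \<le> outer_measure_of (P x) ?E"
      using A(2) by (intro outer_measure_of_mono) blast
    also have "\<dots> = emeasure (P x) ?E" by (intro outer_measure_of_eq) measurable
    finally show ?thesis
      using emeasure_X_chain[OF A(1) simplex_I_sorted(1)[OF l t]] by simp
  qed
  then have "(\<integral>\<^sup>+x. indicator \<Omega> x *
        outer_measure_of (P x) {\<omega>\<in>space (P x). \<forall>s\<in>{0..t}. X s \<omega> \<in> \<Omega>} \<partial>lebesgue)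
    \<le> (\<integral>\<^sup>+x. nchain \<alpha> A (\<lambda>_ _. 1) 0 x ?ss \<partial>lebesgue)"
    by (intro nn_integral_mono) (auto simp: indicator_def)
  then show ?thesis by (simp add: visit_integral_def nn_integral_completion)
qed

lemma
  assumes t: "0 < t" and A: "A \<in> sets borel" "\<Omega> \<subseteq> A" "A - \<Omega> \<in> null_sets lebesgue"
    and fin: "emeasure lborel A < \<infinity>"
  shows Tk_le: "Tk \<alpha> B Y \<Omega> (Suc n) t \<le> t ^ Suc n * measure lborel A"
    and ennreal_Tk: "ennreal (Tk \<alpha> B Y \<Omega> (Suc n) t) = fact (Suc n) * ennreal (t ^ Suc n) *
     (\<integral>\<^sup>+l. indicator (simplex_I (Suc n)) l * visit_integral A (Suc n) t l \<partial>PiM {..<Suc n} (\<lambda>_. lborel))"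
proof -
  let ?M = "PiM {..<Suc n} (\<lambda>_. lborel :: real measure)"
  let ?I = "\<integral>\<^sup>+l. indicator (simplex_I (Suc n)) l * visit_integral A (Suc n) t l \<partial>?M"
  have "?I \<le> (\<integral>\<^sup>+l. emeasure lborel A * indicator (simplex_I (Suc n)) l \<partial>?M)"
    using visit_integral_le[OF A(1) t] by (intro nn_integral_mono) (auto simp: indicator_def)
  also have "\<dots> = emeasure lborel A * emeasure ?M (simplex_I (Suc n))"
    by (rule nn_integral_cmult_indicator) (rule measurable_simplex_I)
  finally have "fact (Suc n) * ennreal (t ^ Suc n) * ?I
      \<le> fact (Suc n) * ennreal (t ^ Suc n) * (emeasure lborel A * emeasure ?M (simplex_I (Suc n)))"
    by (rule mult_left_mono) simp
  also have "\<dots> = ennreal (t ^ Suc n) * emeasure lborel A * (fact (Suc n) * emeasure ?M (simplex_I (Suc n)))"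
    by (simp only: mult_ac)
  also have "\<dots> = ennreal (t ^ Suc n * measure lborel A)"
    unfolding emeasure_simplex_I using t fin by (simp add: emeasure_eq_ennreal_measure ennreal_mult del: power_Suc)
  finally have le: "fact (Suc n) * ennreal (t ^ Suc n) * ?I \<le> ennreal (t ^ Suc n * measure lborel A)" .
  \<comment> \<open>The bound just obtained is finite, which is what allows \<open>enn2real\<close>
    in the formula for \<open>Tk\<close> to be undone.\<close>
  have "fact (Suc n) * ennreal (t ^ Suc n) * ?I < \<top>"
    using le by (rule le_less_trans) simp
  then show eq: "ennreal (Tk \<alpha> B Y \<Omega> (Suc n) t) = fact (Suc n) * ennreal (t ^ Suc n) * ?I"
    unfolding Tk_eq_simplex_integral[OF t A] by (rule ennreal_enn2real)
  have "ennreal (Tk \<alpha> B Y \<Omega> (Suc n) t) \<le> ennreal (t ^ Suc n * measure lborel A)"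
    using le unfolding eq .
  then show "Tk \<alpha> B Y \<Omega> (Suc n) t \<le> t ^ Suc n * measure lborel A"
    by (rule ennreal_le_iff[THEN iffD1, rotated]) (use t in simp)
qed

text \<open>Since the simplex has volume \<open>1 / fact (Suc n)\<close>, \<open>Tk\<close> divided
  by \<open>t ^ Suc n\<close> is an average of \<open>visit_integral\<close> over it, and a uniform
  lower bound passes to the average. It serves both the comparison with the spectral heat content
  and the limit.\<close>

lemma le_Tk:
  assumes t: "0 < t" and A: "A \<in> sets borel" "\<Omega> \<subseteq> A" "A - \<Omega> \<in> null_sets lebesgue"
    and fin: "emeasure lborel A < \<infinity>"
    and c: "\<And>l. l \<in> simplex_I (Suc n) \<Longrightarrow> c \<le> visit_integral A (Suc n) t l"
  shows "ennreal (t ^ Suc n) * c \<le> ennreal (Tk \<alpha> B Y \<Omega> (Suc n) t)"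
proof -
  let ?M = "PiM {..<Suc n} (\<lambda>_. lborel :: real measure)"
  let ?I = "\<integral>\<^sup>+l. indicator (simplex_I (Suc n)) l * visit_integral A (Suc n) t l \<partial>?M"
  have "ennreal (t ^ Suc n) * c = ennreal (t ^ Suc n) * c * (fact (Suc n) * emeasure ?M (simplex_I (Suc n)))"
    unfolding emeasure_simplex_I by simp
  also have "\<dots> = fact (Suc n) * ennreal (t ^ Suc n) * (c * emeasure ?M (simplex_I (Suc n)))"
    by (simp only: mult_ac)
  also have "c * emeasure ?M (simplex_I (Suc n)) = (\<integral>\<^sup>+l. c * indicator (simplex_I (Suc n)) l \<partial>?M)"
    by (rule nn_integral_cmult_indicator[symmetric]) (rule measurable_simplex_I)
  also have "fact (Suc n) * ennreal (t ^ Suc n) * \<dots> \<le> fact (Suc n) * ennreal (t ^ Suc n) * ?I"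
    using c by (intro mult_left_mono nn_integral_mono) (auto simp: indicator_def)
  finally show ?thesis unfolding ennreal_Tk[OF t A fin] .
qed

section \<open>Behaviour for short times\<close>

text \<open>Almost every path starts at \<open>z\<close> and is right-continuous, hence lies in the
  open set \<open>U\<close> at the time \<open>S n\<close> for all large \<open>n\<close>. Dominated
  convergence then applies to the indicators of the complementary events.\<close>

lemma exit_probability_tendsto_0:
  fixes z :: 'a
  assumes U: "open U" and z: "z \<in> U"
    and S: "\<And>n. 0 < S n" "S \<longlonglongrightarrow> 0"
  shows "(\<lambda>n. nchain \<alpha> (- U) (\<lambda>_ _. 1) 0 z [S n]) \<longlonglongrightarrow> 0"
proof -
  interpret prob_space "P z" by (rule prob_space_P)
  let ?N = "\<lambda>n. {\<omega>\<in>space (P z). X (S n) \<omega> \<in> - U}"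
  note [measurable] = measurable_X borel_open[OF U]
  have N: "?N n \<in> sets (P z)" for n by measurable
  have eq: "nchain \<alpha> (- U) (\<lambda>_ _. 1) 0 z [S n] = (\<integral>\<^sup>+\<omega>. indicator (?N n) \<omega> \<partial>P z)" for n
    using emeasure_X_chain[of "- U" "[S n]" z] S(1)[of n] N by simp
  have S_lim: "filterlim S (at_right 0) sequentially"
    unfolding filterlim_at using S by (auto intro!: always_eventually simp: less_imp_neq[symmetric])
  have "(\<lambda>n. \<integral>\<^sup>+\<omega>. indicator (?N n) \<omega> \<partial>P z) \<longlonglongrightarrow> (\<integral>\<^sup>+\<omega>. 0 \<partial>P z)"
  proof (rule nn_integral_dominated_convergence[where w = "\<lambda>_. 1"])
    show "AE \<omega> in P z. (\<lambda>n. indicator (?N n) \<omega> :: ennreal) \<longlonglongrightarrow> 0"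
      using AE_X_0[of z] AE_space
    proof eventually_elim
      case (elim \<omega>)
      have "((\<lambda>s. X s \<omega>) \<longlongrightarrow> z) (at_right 0)"
        using cadlag_X[OF elim(2)] elim(1) by (force simp: cadlag_on_def)
      then have "(\<lambda>n. X (S n) \<omega>) \<longlonglongrightarrow> z" by (rule filterlim_compose[OF _ S_lim])
      then have "eventually (\<lambda>n. X (S n) \<omega> \<in> U) sequentially" using U z by (rule topological_tendstoD)
      then have "eventually (\<lambda>n. indicator (?N n) \<omega> = (0::ennreal)) sequentially"
        by eventually_elim simp
      then show ?case by (rule tendsto_eventually)
    qed
  qed (use N in \<open>auto simp: emeasure_space_1 indicator_def\<close>)
  then show ?thesis by (simp add: eq del: nchain.simps)
qed

text \<open>The mass that, started from Lebesgue measure on \<open>A\<close>, is found outside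
  \<open>D\<close> at the single time \<open>s\<close>; what the path does before \<open>s\<close>
  is disregarded.\<close>

definition escape :: "'a set \<Rightarrow> 'a set \<Rightarrow> real \<Rightarrow> ennreal" where
  "escape A D s = (\<integral>\<^sup>+z. indicator A z * nchain \<alpha> (- D) (\<lambda>_ _. 1) 0 z [s] \<partial>lborel)"

text \<open>The integrand vanishes in the limit at each point of \<open>A\<close>, since
  \<open>U\<close> is open and contains it, and is dominated by the integrable indicator of
  \<open>A\<close>.\<close>

lemma escape_tendsto_0:
  assumes A [measurable]: "A \<in> sets borel" and fin: "emeasure lborel A < \<infinity>" and U: "open U" "A \<subseteq> U"
  shows "(escape A U \<longlongrightarrow> 0) (at_right 0)"
proof (rule tendsto_at_right_sequentially[where b = 1])
  fix S :: "nat \<Rightarrow> real" assume S: "\<And>n. 0 < S n" "S \<longlonglongrightarrow> 0"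
  have U': "- U \<in> sets borel" using U by auto
  have [measurable]: "(\<lambda>z. nchain \<alpha> (- U) (\<lambda>_ _. 1) 0 z [s]) \<in> borel_measurable borel" for s
    by (rule measurable_nchain_fixed[OF U']) simp
  have "(\<lambda>n. escape A U (S n)) \<longlonglongrightarrow> (\<integral>\<^sup>+z. 0 \<partial>(lborel :: 'a measure))"
    unfolding escape_def
  proof (rule nn_integral_dominated_convergence[where w = "indicator A"])
    show "AE z in lborel. indicator A z * nchain \<alpha> (- U) (\<lambda>_ _. 1) 0 z [S n] \<le> indicator A z" for n
      using nchain_one_le_1(1)[OF U', of 0 "[S n]"] S(1)[of n]
      by (auto simp: indicator_def simp del: nchain.simps)
    show "AE z in lborel. (\<lambda>n. indicator A z * nchain \<alpha> (- U) (\<lambda>_ _. 1) 0 z [S n]) \<longlonglongrightarrow> 0"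
    proof (rule AE_I2)
      fix z
      show "(\<lambda>n. indicator A z * nchain \<alpha> (- U) (\<lambda>_ _. 1) 0 z [S n]) \<longlonglongrightarrow> 0"
        using exit_probability_tendsto_0[OF U(1) _ S, of z] U(2)
        by (cases "z \<in> A") (auto simp del: nchain.simps)
    qed
  qed (use fin in \<open>simp_all del: nchain.simps\<close>)
  then show "(\<lambda>n. escape A U (S n)) \<longlonglongrightarrow> 0" by simp
qed simp

text \<open>Outer regularity reduces the claim to open sets, where paths starting inside do not leave
  immediately; the remaining part is small because Lebesgue measure is invariant for the process.\<close>
lemma escape_self_tendsto_0:
  assumes A [measurable]: "A \<in> sets borel" and fin: "emeasure lborel A < \<infinity>" and e: "0 < e"
  shows "eventually (\<lambda>s. escape A A s < ennreal e) (at_right 0)"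
proof -
  obtain U where U: "open U" "A \<subseteq> U" "emeasure lebesgue (U - A) < ennreal (e / 2)"
    using sets_lebesgue_outer_open[of A "e / 2"] e A by auto
  have Ub [measurable]: "U \<in> sets borel" using U by auto
  have UA: "emeasure lborel (U - A) < ennreal (e / 2)" using U(3) by simp
  have "eventually (\<lambda>s. escape A U s < ennreal (e / 2)) (at_right 0)"
    using escape_tendsto_0[OF A fin U(1,2)] by (rule order_tendstoD) (use e in simp)
  moreover have "eventually (\<lambda>s. 0 < s) (at_right (0::real))" by (rule eventually_at_right_less)
  ultimately show ?thesis
  proof eventually_elim
    case (elim s)
    have [measurable]: "(\<lambda>z. nchain \<alpha> D (\<lambda>_ _. 1) 0 z [s]) \<in> borel_measurable borel" if "D \<in> sets borel" for D
      by (rule measurable_nchain_fixed[OF that]) simp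
    have split: "nchain \<alpha> (- A) (\<lambda>_ _. 1) 0 z [s]
        = nchain \<alpha> (- U) (\<lambda>_ _. 1) 0 z [s] + nchain \<alpha> (U - A) (\<lambda>_ _. 1) 0 z [s]" for z
      using U(2) by (auto simp: nn_integral_add[symmetric] indicator_def intro!: nn_integral_cong)
    have "escape A A s \<le> (\<integral>\<^sup>+z. indicator A z * nchain \<alpha> (- U) (\<lambda>_ _. 1) 0 z [s]
        + nchain \<alpha> (U - A) (\<lambda>_ _. 1) 0 z [s] \<partial>lborel)"
      unfolding escape_def split by (intro nn_integral_mono) (auto simp: indicator_def simp del: nchain.simps)
    also have "\<dots> = escape A U s + (\<integral>\<^sup>+z. nchain \<alpha> (U - A) (\<lambda>_ _. 1) 0 z [s] \<partial>lborel)"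
      unfolding escape_def by (intro nn_integral_add) (simp_all del: nchain.simps)
    also have "(\<integral>\<^sup>+z. nchain \<alpha> (U - A) (\<lambda>_ _. 1) 0 z [s] \<partial>lborel) = emeasure lborel (U - A)"
      using nn_integral_nchain_initial[of "U - A" 0 s "[]"] elim(2) by (simp del: nchain.simps(2))
    also have "escape A U s + emeasure lborel (U - A) < ennreal (e / 2) + ennreal (e / 2)"
      using elim(1) UA by (rule add_strict_mono)
    also have "\<dots> = ennreal e" using e by (simp flip: ennreal_plus)
    finally show ?case .
  qed
qed

text \<open>A union bound: after a first visit in \<open>A\<close>, a path is either in
  \<open>A\<close> at all the later times or outside \<open>A\<close> at one of them. The cost of
  each later time is an escape over its gap to the first visit.\<close>

lemma visit_integral_plus_escape:
  assumes A [measurable]: "A \<in> sets borel" and t: "0 < t" and l: "l \<in> simplex_I (Suc n)"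
  shows "emeasure lborel A \<le> visit_integral A (Suc n) t l + (\<Sum>i\<in>{1..<Suc n}. escape A A (t * l i - t * l 0))"
proof -
  let ?s = "\<lambda>i. t * l i - t * l 0"
  let ?c = "\<lambda>z. nchain \<alpha> A (\<lambda>_ _. 1) (t * l 0) z (map (\<lambda>i. t * l i) [1..<Suc n])"
  have A': "- A \<in> sets borel" by simp
  have srt: "sorted_wrt (<) (t * l 0 # map (\<lambda>i. t * l i) [1..<Suc n])"
    using simplex_I_sorted(1)[OF l t] by (simp add: upt_conv_Cons del: upt_Suc)
  then have srt': "sorted_wrt (<) (0 # map ?s [1..<Suc n])"
    by (simp add: sorted_wrt_map)
  have pos: "0 < ?s i" if "i \<in> {1..<Suc n}" for i using srt that by (simp del: upt_Suc)
  have [measurable]: "?c \<in> borel_measurable borel"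
    by (rule measurable_nchain_fixed[OF A]) simp
  have [measurable]: "(\<lambda>z. nchain \<alpha> (- A) (\<lambda>_ _. 1) 0 z [s]) \<in> borel_measurable borel" for s
    by (rule measurable_nchain_fixed[OF A']) simp
  have one: "1 \<le> ?c z + (\<Sum>i\<in>{1..<Suc n}. nchain \<alpha> (- A) (\<lambda>_ _. 1) 0 z [?s i])" for z
  proof -
    interpret prob_space "P z" by (rule prob_space_P)
    note [measurable] = measurable_X
    let ?E = "{\<omega>\<in>space (P z). \<forall>s\<in>set (map ?s [1..<Suc n]). X s \<omega> \<in> A}"
    let ?N = "\<lambda>i. {\<omega>\<in>space (P z). \<forall>s\<in>set [?s i]. X s \<omega> \<in> - A}"
    have E: "?E \<in> sets (P z)" by measurable
    have N: "?N i \<in> sets (P z)" for i by measurable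
    \<comment> \<open>Time is shifted so that the first visit happens at time 0, where the law
      \<open>P z\<close> starts.\<close>
    have "?c z = nchain \<alpha> A (\<lambda>_ _. 1) 0 z (map ?s [1..<Suc n])"
      using nchain_shift[of \<alpha> A 0 "t * l 0" z "map ?s [1..<Suc n]"] by (simp add: comp_def del: upt_Suc)
    then have cE: "?c z = emeasure (P z) ?E"
      using emeasure_X_chain[OF A srt'] by simp
    have "1 = emeasure (P z) (space (P z))" by (simp add: emeasure_space_1)
    also have "\<dots> \<le> emeasure (P z) (?E \<union> (\<Union>i\<in>{1..<Suc n}. ?N i))"
      using E N by (intro emeasure_mono) auto
    also have "\<dots> \<le> emeasure (P z) ?E + emeasure (P z) (\<Union>i\<in>{1..<Suc n}. ?N i)"
      using E N by (intro emeasure_subadditive sets.finite_UN) auto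
    also have "\<dots> \<le> emeasure (P z) ?E + (\<Sum>i\<in>{1..<Suc n}. emeasure (P z) (?N i))"
      using N by (intro add_left_mono emeasure_subadditive_finite) auto
    also have "(\<Sum>i\<in>{1..<Suc n}. emeasure (P z) (?N i)) = (\<Sum>i\<in>{1..<Suc n}. nchain \<alpha> (- A) (\<lambda>_ _. 1) 0 z [?s i])"
      by (intro sum.cong refl emeasure_X_chain[OF A']) (use pos in simp)
    finally show ?thesis unfolding cE .
  qed
  have "emeasure lborel A = (\<integral>\<^sup>+z. indicator A z * 1 \<partial>lborel)" by simp
  also have "\<dots> \<le> (\<integral>\<^sup>+z. indicator A z * (?c z + (\<Sum>i\<in>{1..<Suc n}. nchain \<alpha> (- A) (\<lambda>_ _. 1) 0 z [?s i])) \<partial>lborel)"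
    by (intro nn_integral_mono mult_left_mono one) simp
  also have "\<dots> = (\<integral>\<^sup>+z. indicator A z * ?c z + (\<Sum>i\<in>{1..<Suc n}. indicator A z * nchain \<alpha> (- A) (\<lambda>_ _. 1) 0 z [?s i]) \<partial>lborel)"
    by (simp only: distrib_left sum_distrib_left)
  also have "\<dots> = visit_integral A (Suc n) t l + (\<Sum>i\<in>{1..<Suc n}. escape A A (?s i))"
    unfolding visit_integral_eq[OF A t l] escape_def
    by (subst nn_integral_add, measurable, subst nn_integral_sum, measurable)
  finally show ?thesis .
qed

lemma Tk_div_power_tendsto:
  assumes A: "A \<in> sets borel" "\<Omega> \<subseteq> A" "A - \<Omega> \<in> null_sets lebesgue"
    and fin: "emeasure lborel A < \<infinity>"
  shows "((\<lambda>t. Tk \<alpha> B Y \<Omega> (Suc n) t / t ^ Suc n) \<longlongrightarrow> measure lborel A) (at_right 0)"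
proof (rule tendstoI)
  fix e :: real assume e: "0 < e"
  \<comment> \<open>At most \<open>n\<close> escape terms occur, so each may cost \<open>d\<close>;
    \<open>Suc n\<close> avoids division by 0 when \<open>n = 0\<close>.\<close>
  define d where "d = e / (2 * Suc n)"
  have d: "0 < d" "real n * d < e"
    using e add_pos_nonneg[of "e * 2" "e * real n"] by (auto simp: d_def field_simps)
  obtain b where b: "0 < b" "\<And>s. 0 < s \<Longrightarrow> s < b \<Longrightarrow> escape A A s < ennreal d"
    using escape_self_tendsto_0[OF A(1) fin d(1)] by (auto simp: eventually_at_right_field)
  have "eventually (\<lambda>t. t \<in> {0<..<b}) (at_right 0)" by (rule eventually_at_right_real) fact
  then show "eventually (\<lambda>t. dist (Tk \<alpha> B Y \<Omega> (Suc n) t / t ^ Suc n) (measure lborel A) < e) (at_right 0)"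
  proof eventually_elim
    case (elim t)
    then have t: "0 < t" "t < b" by auto
    let ?c = "measure lborel A - real n * d"
    have "ennreal (t ^ Suc n) * ennreal ?c \<le> ennreal (Tk \<alpha> B Y \<Omega> (Suc n) t)"
    proof (rule le_Tk[OF t(1) A fin])
      fix l assume l: "l \<in> simplex_I (Suc n)"
      have "escape A A (t * l i - t * l 0) \<le> ennreal d" if "i \<in> {1..<Suc n}" for i
      proof -
        have "\<forall>j\<in>{1..<Suc n}. t * l 0 < t * l j" "0 < t * l 0" "t * l i < t"
          using simplex_I_sorted[OF l t(1)] that by (simp_all add: upt_conv_Cons del: upt_Suc)
        moreover from this(1) that have "t * l 0 < t * l i" by blast
        \<comment> \<open>Every gap \<open>t * l i - t * l 0\<close> lies between 0 and
          \<open>t\<close>, so \<open>t < b\<close> controls all of them uniformly in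
          \<open>l\<close>.\<close>
        ultimately show ?thesis using t by (intro less_imp_le b(2)) linarith+
      qed
      then have "(\<Sum>i\<in>{1..<Suc n}. escape A A (t * l i - t * l 0)) \<le> (\<Sum>i\<in>{1..<Suc n}. ennreal d)"
        by (rule sum_mono)
      also have "\<dots> = ennreal (real n * d)" using d by (simp add: ennreal_mult ennreal_of_nat_eq_real_of_nat)
      finally have "emeasure lborel A \<le> visit_integral A (Suc n) t l + ennreal (real n * d)"
        using visit_integral_plus_escape[OF A(1) t(1) l] add_left_mono order_trans by blast
      then have "emeasure lborel A - ennreal (real n * d) \<le> visit_integral A (Suc n) t l"
        by (simp add: ennreal_minus_le_iff add.commute)
      then show "ennreal ?c \<le> visit_integral A (Suc n) t l"
        using fin d by (simp add: emeasure_eq_ennreal_measure ennreal_minus)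
    qed
    moreover have Tk_nonneg: "0 \<le> Tk \<alpha> B Y \<Omega> (Suc n) t"
      unfolding Tk_eq_simplex_integral[OF t(1) A] by simp
    ultimately have "t ^ Suc n * ?c \<le> Tk \<alpha> B Y \<Omega> (Suc n) t"
    \<comment> \<open>\<open>ennreal\<close> truncates a negative \<open>?c\<close> to 0, so that
      case rests on the nonnegativity of \<open>Tk\<close> instead.\<close>
    proof (cases "0 \<le> ?c")
      case True
      then show ?thesis
        using \<open>ennreal (t ^ Suc n) * ennreal ?c \<le> _\<close> Tk_nonneg t(1)
        by (simp flip: ennreal_mult del: power_Suc)
    next
      case False
      then have "t ^ Suc n * ?c \<le> 0" using t(1) by (intro mult_nonneg_nonpos) simp_all
      then show ?thesis using Tk_nonneg by linarith
    qed
    then have "?c \<le> Tk \<alpha> B Y \<Omega> (Suc n) t / t ^ Suc n"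
      using t(1) by (simp add: pos_le_divide_eq mult.commute del: power_Suc)
    moreover have "Tk \<alpha> B Y \<Omega> (Suc n) t / t ^ Suc n \<le> measure lborel A"
      using Tk_le[OF t(1) A fin, of n] t(1) by (simp add: pos_divide_le_eq mult.commute del: power_Suc)
    ultimately show ?case using d by (simp add: dist_real_def del: power_Suc)
  qed
qed

end

section \<open>Time zero and conclusion\<close>

text \<open>Whatever the measure \<open>B 0 x y\<close> may be, the occupation time is an integral
  over a single point, and a positive power of 0 is 0.\<close>

lemma Tk_zero:
  assumes "0 < k"
  shows "Tk \<alpha> B Y \<Omega> k 0 = 0"
proof -
  have "occupation \<Omega> Y 0 \<omega> = 0" for \<omega>
  proof -
    have "AE s in lebesgue. s \<noteq> (0::real)" by (intro AE_completion AE_lborel_singleton)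
    then have "AE s in lebesgue. indicator {0..0::real} s *\<^sub>R (indicator \<Omega> (Y s \<omega>) :: real) = 0"
      by eventually_elim simp
    then show ?thesis
      unfolding occupation_def set_lebesgue_integral_def by (rule integral_eq_zero_AE)
  qed
  with \<open>0 < k\<close> show ?thesis by (simp add: Tk_def zero_power)
qed

theorem theorem2p2:
  fixes \<alpha> :: real and \<Omega> :: "'a::euclidean_space set" and k :: nat
    and P :: "'a \<Rightarrow> 'w measure" and X :: "real \<Rightarrow> 'w \<Rightarrow> 'a"
    and B :: "real \<Rightarrow> 'a \<Rightarrow> 'a \<Rightarrow> 'v measure" and Y :: "real \<Rightarrow> 'v \<Rightarrow> 'a"
  assumes "0 < \<alpha>" and "\<alpha> \<le> 2" and "DIM('a) \<ge> 2"
    and "\<Omega> \<in> sets lebesgue" and "emeasure lebesgue \<Omega> < \<infinity>"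
    and "k \<ge> 1"
    and "is_stable_process \<alpha> P X"
    and "\<forall>t>0. \<forall>x y. is_stable_bridge \<alpha> t x y (B t x y) Y"
  shows "(\<forall>t\<ge>0.
            t ^ k * spectral_heat_content P X \<Omega> t \<le> Tk \<alpha> B Y \<Omega> k t
          \<and> Tk \<alpha> B Y \<Omega> k t \<le> t ^ k * measure lebesgue \<Omega>
          \<and> Tk \<alpha> B Y \<Omega> k t =
              fact k * t ^ k *
              (\<integral>l. indicator (simplex_I k) l *
                    hk \<alpha> \<Omega> t (map (\<lambda>i. l (Suc i) - l i) [0..<k - 1])
                 \<partial>(Pi\<^sub>M {..<k} (\<lambda>_. lborel))))
       \<and> ((\<lambda>t. Tk \<alpha> B Y \<Omega> k t / t ^ k) \<longlongrightarrow> measure lebesgue \<Omega>) (at_right 0)"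
proof -
  interpret stable_process_with_bridges \<alpha> P X B Y
    using assms by unfold_locales auto
  obtain n where k: "k = Suc n" using \<open>k \<ge> 1\<close> by (cases k) auto
  obtain A where A: "\<Omega> \<subseteq> A" "A \<in> sets lborel" "A - \<Omega> \<in> null_sets lebesgue"
      "emeasure lebesgue \<Omega> = emeasure lborel A"
    using completion_upper[OF assms(4)] by blast
  have Ab: "A \<in> sets borel" using A(2) by simp
  have fin: "emeasure lborel A < \<infinity>" using A(4) assms(5) by simp
  have meas: "measure lebesgue \<Omega> = measure lborel A" using A(4) by (simp add: measure_def)
  have "AE w in lebesgue. w \<notin> A - \<Omega>" by (rule AE_not_in[OF A(3)])
  then have ae: "AE w in lborel. w \<in> \<Omega> \<longleftrightarrow> w \<in> A"
    unfolding AE_completion_iff by eventually_elim (use A(1) in auto)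
  let ?I = "\<lambda>t. \<integral>l. indicator (simplex_I (Suc n)) l * hk \<alpha> \<Omega> t (map (\<lambda>i. l (Suc i) - l i) [0..<n])
      \<partial>(Pi\<^sub>M {..<Suc n} (\<lambda>_. lborel))"
  have formula: "Tk \<alpha> B Y \<Omega> (Suc n) t = fact (Suc n) * t ^ Suc n * ?I t" if t: "0 < t" for t
    using t unfolding simplex_integral_eq_hk[OF t Ab fin ae, symmetric] Tk_eq_simplex_integral[OF t Ab A(1,3)]
    by (simp add: enn2real_mult del: power_Suc fact_Suc flip: ennreal_fact)
  have lower: "t ^ Suc n * spectral_heat_content P X \<Omega> t \<le> Tk \<alpha> B Y \<Omega> (Suc n) t" if t: "0 < t" for t
  proof -
    let ?q = "\<integral>\<^sup>+x. indicator \<Omega> x *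
        outer_measure_of (P x) {\<omega>\<in>space (P x). \<forall>s\<in>{0..t}. X s \<omega> \<in> \<Omega>} \<partial>lebesgue"
    have "ennreal (t ^ Suc n) * ?q \<le> ennreal (Tk \<alpha> B Y \<Omega> (Suc n) t)"
      by (rule le_Tk[OF t Ab A(1,3) fin]) (rule spectral_heat_content_le_visit_integral[OF t Ab A(1)])
    \<comment> \<open>Monotonicity of \<open>enn2real\<close> needs a finite right-hand side, which
      holds because it is the image of a real number.\<close>
    then have "enn2real (ennreal (t ^ Suc n) * ?q) \<le> enn2real (ennreal (Tk \<alpha> B Y \<Omega> (Suc n) t))"
      by (rule enn2real_mono) simp
    moreover have "0 \<le> Tk \<alpha> B Y \<Omega> (Suc n) t"
      unfolding Tk_eq_simplex_integral[OF t Ab A(1,3)] by simp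
    ultimately show ?thesis
      using t by (simp add: spectral_heat_content_def enn2real_mult del: power_Suc)
  qed
  have "t ^ Suc n * spectral_heat_content P X \<Omega> t \<le> Tk \<alpha> B Y \<Omega> (Suc n) t
      \<and> Tk \<alpha> B Y \<Omega> (Suc n) t \<le> t ^ Suc n * measure lborel A
      \<and> Tk \<alpha> B Y \<Omega> (Suc n) t = fact (Suc n) * t ^ Suc n * ?I t" if "0 \<le> t" for t
  \<comment> \<open>The bridge law is prescribed only for positive length. At \<open>t = 0\<close>
    all the quantities compared are 0, since the exponent is positive.\<close>
  proof (cases "t = 0")
    case True
    then show ?thesis using Tk_zero[of "Suc n" \<alpha> B Y \<Omega>] by simp
  next
    case False
    with that have "0 < t" by simp
    then show ?thesis using lower formula Tk_le[OF _ Ab A(1,3) fin] by blast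
  qed
  moreover have "((\<lambda>t. Tk \<alpha> B Y \<Omega> (Suc n) t / t ^ Suc n) \<longlongrightarrow> measure lborel A) (at_right 0)"
    by (rule Tk_div_power_tendsto[OF Ab A(1,3) fin])
  ultimately show ?thesis unfolding k meas diff_Suc_1 by blast
qed

end
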